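(* Let $\mathbb{A}$ be an algebraically coherent semi-abelian category, and let $M,N\lhd L$ be normal subobjects of an object $L$ of $\mathbb{A}$, viewed as internal $L$-crossed modules (with the conjugation actions of $L$). Let $h\colon M\otimes N\to M\wedge N$ be the canonical morphism from the non-abelian tensor product of these two crossed modules to the intersection of $M$ and $N$, induced by the crossed square structure on the intersection of $M$ and $N$. Then the image of $h$ is the Higgins commutator $[M,N]\leq M\wedge N$.
   Context: A semi-abelian category is a pointed, Barr exact, Bourn protomodular category with binary coproducts. $\binom fg$ is the arrow induced on a coproduct; $K_f$ is the kernel of $f$; $X\flat Y$ is the kernel of $\binom{1_X}{0}\colon X+Y\to X$. $\mathbb{A}$ is algebraically coherent when for all $X,Y,Z$ the comparison morphism $\binom{1_X\flat\iota_Y}{1_X\flat\iota_Z}\colon X\flat Y+X\flat Z\to X\flat(Y+Z)$ is a regular epimorphism. The Higgins commutator $[A,B]\leq X$ of subobjects of $X$ is the image in $X$ of the kernel $A\diamond B$ of the canonical morphism $A+B\to A\times B$; the Huq commutator $[A,B]^{\mathcal Q}_X$ is its normal closure in $X$. Normal subobjects as groupoids: a normal subobject $M\lhd L$ corresponds to the equivalence relation $R\rightrightarrows L$ which is the kernel pair of the cokernel $L\to L/M$; this is an internal groupoid, and it is the one corresponding to the crossed module given by the inclusion $M\to L$ with the conjugation action of $L$. Write $(R,L,d_M,c_M,e_M)$ for it (domain, codomain, identities; $K_{d_M}=M$) and $(S,L,d_N,c_N,e_N)$ for the one corresponding to $N$. Tensor product. Let $Q$ be the pushout of $e_M$ and $e_N$,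 with canonical morphisms $e_U\colon R\to Q$ and $e_L\colon S\to Q$; let $d_U,c_U\colon Q\to R$ be determined by $d_Ue_U=1=c_Ue_U$, $d_Ue_L=e_Md_N$, $c_Ue_L=e_Mc_N$, and $d_L,c_L\colon Q\to S$ by $d_Le_L=1=c_Le_L$, $d_Le_U=e_Nd_M$, $c_Le_U=e_Nc_M$. Put $Q_{M\otimes N}=Q/([K_{d_L},K_{c_L}]^{\mathcal Q}_Q\vee[K_{d_U},K_{c_U}]^{\mathcal Q}_Q)$ with the induced morphisms $\overline{d_U},\overline{c_U}\colon Q_{M\otimes N}\to R$ and $\overline{d_L},\overline{c_L}\colon Q_{M\otimes N}\to S$. Then $Q_{M\otimes N}$ is the upper left corner of an internal double groupoid over $R$ and $S$, and $M\otimes N=K_{\overline{d_U}}\wedge K_{\overline{d_L}}$. Canonical map. The double equivalence relation $R\square S$ (the object of "squares" with two opposite edges in $R$ and two opposite edges in $S$) is an internal double groupoid over $R$ and $S$ whose normalisation (intersection of the kernels of the two domain morphisms) is $M\wedge N$. By initiality of $Q_{M\otimes N}$ amongst double groupoids over $R$ and $S$ there is a unique morphism of double groupoids from $Q_{M\otimes N}$ to $R\square S$ which is the identity on $R$, $S$ and $L$; its restriction to the intersections of kernels is $h\colon M\otimes N\to M\wedge N$. *)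

theory Defs
  imports Main
begin

section \<open>Categories\<close>

record ('o, 'a) cat =
  Obj :: "'o set"
  Arr :: "'a set"
  Dom :: "'a \<Rightarrow> 'o"
  Cod :: "'a \<Rightarrow> 'o"
  Ident :: "'o \<Rightarrow> 'a"
  Comp :: "'a \<Rightarrow> 'a \<Rightarrow> 'a"  (infixl "\<cdot>\<index>" 70)

definition Hom :: "('o, 'a) cat \<Rightarrow> 'o \<Rightarrow> 'o \<Rightarrow> 'a set" where
  "Hom C X Y = {f \<in> Arr C. Dom C f = X \<and> Cod C f = Y}"

locale category =
  fixes C :: "('o, 'a) cat" (structure)
  assumes Dom_in_Obj: "f \<in> Arr C \<Longrightarrow> Dom C f \<in> Obj C"
    and Cod_in_Obj: "f \<in> Arr C \<Longrightarrow> Cod C f \<in> Obj C"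
    and Ident_in_Hom: "X \<in> Obj C \<Longrightarrow> Ident C X \<in> Hom C X X"
    and Comp_in_Hom: "f \<in> Hom C X Y \<Longrightarrow> g \<in> Hom C Y Z \<Longrightarrow> g \<cdot> f \<in> Hom C X Z"
    and Comp_Ident: "f \<in> Hom C X Y \<Longrightarrow> f \<cdot> Ident C X = f"
    and Ident_Comp: "f \<in> Hom C X Y \<Longrightarrow> Ident C Y \<cdot> f = f"
    and Comp_assoc: "f \<in> Hom C W X \<Longrightarrow> g \<in> Hom C X Y \<Longrightarrow> h \<in> Hom C Y Z \<Longrightarrow>
      (h \<cdot> g) \<cdot> f = h \<cdot> (g \<cdot> f)"


section \<open>Limits, colimits and special arrows\<close>

text \<open>
  Universal objects are never chosen: a limit or colimit is given by a predicate on its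
  structural arrows. Subobjects of \<open>X\<close> are represented by monomorphisms with codomain \<open>X\<close>.
\<close>

context
  fixes C :: "('o, 'a) cat" (structure)
begin

definition is_mono :: "'a \<Rightarrow> bool" where
  "is_mono f \<longleftrightarrow> f \<in> Arr C \<and>
    (\<forall>T. \<forall>x\<in>Hom C T (Dom C f). \<forall>y\<in>Hom C T (Dom C f). f \<cdot> x = f \<cdot> y \<longrightarrow> x = y)"

definition is_iso :: "'a \<Rightarrow> bool" where
  "is_iso f \<longleftrightarrow> f \<in> Arr C \<and>
    (\<exists>g\<in>Hom C (Cod C f) (Dom C f). g \<cdot> f = Ident C (Dom C f) \<and> f \<cdot> g = Ident C (Cod C f))"

definition is_terminal :: "'o \<Rightarrow> bool" where
  "is_terminal Z \<longleftrightarrow> Z \<in> Obj C \<and> (\<forall>X\<in>Obj C. \<exists>!f. f \<in> Hom C X Z)"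

definition is_zero_object :: "'o \<Rightarrow> bool" where
  "is_zero_object Z \<longleftrightarrow> is_terminal Z \<and> (\<forall>X\<in>Obj C. \<exists>!f. f \<in> Hom C Z X)"

definition is_zero :: "'a \<Rightarrow> bool" where
  "is_zero f \<longleftrightarrow> f \<in> Arr C \<and>
    (\<exists>Z g h. is_zero_object Z \<and> g \<in> Hom C (Dom C f) Z \<and> h \<in> Hom C Z (Cod C f) \<and> f = h \<cdot> g)"

definition is_coequalizer :: "'a \<Rightarrow> 'a \<Rightarrow> 'a \<Rightarrow> bool" where
  "is_coequalizer f g q \<longleftrightarrow> f \<in> Arr C \<and> g \<in> Hom C (Dom C f) (Cod C f) \<and>
    q \<in> Arr C \<and> Dom C q = Cod C f \<and> q \<cdot> f = q \<cdot> g \<and>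
    (\<forall>T. \<forall>t\<in>Hom C (Cod C f) T. t \<cdot> f = t \<cdot> g \<longrightarrow> (\<exists>!u. u \<in> Hom C (Cod C q) T \<and> u \<cdot> q = t))"

definition is_regular_epi :: "'a \<Rightarrow> bool" where
  "is_regular_epi q \<longleftrightarrow> (\<exists>f g. is_coequalizer f g q)"

definition is_kernel :: "'a \<Rightarrow> 'a \<Rightarrow> bool" where
  "is_kernel f k \<longleftrightarrow> f \<in> Arr C \<and> k \<in> Arr C \<and> Cod C k = Dom C f \<and> is_zero (f \<cdot> k) \<and>
    (\<forall>T. \<forall>t\<in>Hom C T (Dom C f). is_zero (f \<cdot> t) \<longrightarrow> (\<exists>!u. u \<in> Hom C T (Dom C k) \<and> k \<cdot> u = t))"

definition is_cokernel :: "'a \<Rightarrow> 'a \<Rightarrow> bool" where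
  "is_cokernel f q \<longleftrightarrow> f \<in> Arr C \<and> q \<in> Arr C \<and> Dom C q = Cod C f \<and> is_zero (q \<cdot> f) \<and>
    (\<forall>T. \<forall>t\<in>Hom C (Cod C f) T. is_zero (t \<cdot> f) \<longrightarrow> (\<exists>!u. u \<in> Hom C (Cod C q) T \<and> u \<cdot> q = t))"

definition is_pullback :: "'a \<Rightarrow> 'a \<Rightarrow> 'a \<Rightarrow> 'a \<Rightarrow> bool" where
  "is_pullback f g p q \<longleftrightarrow> f \<in> Arr C \<and> g \<in> Arr C \<and> Cod C f = Cod C g \<and>
    p \<in> Arr C \<and> Cod C p = Dom C f \<and> q \<in> Hom C (Dom C p) (Dom C g) \<and> f \<cdot> p = g \<cdot> q \<and>
    (\<forall>T. \<forall>x\<in>Hom C T (Dom C f). \<forall>y\<in>Hom C T (Dom C g). f \<cdot> x = g \<cdot> y \<longrightarrow>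
      (\<exists>!u. u \<in> Hom C T (Dom C p) \<and> p \<cdot> u = x \<and> q \<cdot> u = y))"

definition is_pushout :: "'a \<Rightarrow> 'a \<Rightarrow> 'a \<Rightarrow> 'a \<Rightarrow> bool" where
  "is_pushout f g i j \<longleftrightarrow> f \<in> Arr C \<and> g \<in> Arr C \<and> Dom C f = Dom C g \<and>
    i \<in> Arr C \<and> Dom C i = Cod C f \<and> j \<in> Hom C (Cod C g) (Cod C i) \<and> i \<cdot> f = j \<cdot> g \<and>
    (\<forall>T. \<forall>x\<in>Hom C (Cod C f) T. \<forall>y\<in>Hom C (Cod C g) T. x \<cdot> f = y \<cdot> g \<longrightarrow>
      (\<exists>!u. u \<in> Hom C (Cod C i) T \<and> u \<cdot> i = x \<and> u \<cdot> j = y))"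

definition is_kernel_pair :: "'a \<Rightarrow> 'a \<Rightarrow> 'a \<Rightarrow> bool" where
  "is_kernel_pair f p q \<longleftrightarrow> is_pullback f f p q"

definition is_product :: "'a \<Rightarrow> 'a \<Rightarrow> bool" where
  "is_product p q \<longleftrightarrow> p \<in> Arr C \<and> q \<in> Arr C \<and> Dom C p = Dom C q \<and>
    (\<forall>T. \<forall>x\<in>Hom C T (Cod C p). \<forall>y\<in>Hom C T (Cod C q).
      \<exists>!u. u \<in> Hom C T (Dom C p) \<and> p \<cdot> u = x \<and> q \<cdot> u = y)"

definition is_coproduct :: "'a \<Rightarrow> 'a \<Rightarrow> bool" where
  "is_coproduct i j \<longleftrightarrow> i \<in> Arr C \<and> j \<in> Arr C \<and> Cod C i = Cod C j \<and>
    (\<forall>T. \<forall>x\<in>Hom C (Dom C i) T. \<forall>y\<in>Hom C (Dom C j) T.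
      \<exists>!u. u \<in> Hom C (Cod C i) T \<and> u \<cdot> i = x \<and> u \<cdot> j = y)"


section \<open>Semi-abelian categories\<close>

definition is_equivalence_relation :: "'a \<Rightarrow> 'a \<Rightarrow> bool" where
  "is_equivalence_relation d c \<longleftrightarrow> d \<in> Arr C \<and> c \<in> Hom C (Dom C d) (Cod C d) \<and>
    (\<forall>T. \<forall>x\<in>Hom C T (Dom C d). \<forall>y\<in>Hom C T (Dom C d).
      d \<cdot> x = d \<cdot> y \<and> c \<cdot> x = c \<cdot> y \<longrightarrow> x = y) \<and>
    (\<exists>e\<in>Hom C (Cod C d) (Dom C d). d \<cdot> e = Ident C (Cod C d) \<and> c \<cdot> e = Ident C (Cod C d)) \<and>
    (\<exists>s\<in>Hom C (Dom C d) (Dom C d). d \<cdot> s = c \<and> c \<cdot> s = d) \<and>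
    (\<forall>p q. is_pullback c d p q \<longrightarrow>
      (\<exists>t\<in>Hom C (Dom C p) (Dom C d). d \<cdot> t = d \<cdot> p \<and> c \<cdot> t = c \<cdot> q))"

definition has_finite_limits :: bool where
  "has_finite_limits \<longleftrightarrow> (\<exists>Z. is_terminal Z) \<and>
    (\<forall>f\<in>Arr C. \<forall>g\<in>Arr C. Cod C f = Cod C g \<longrightarrow> (\<exists>p q. is_pullback f g p q))"

definition is_regular :: bool where
  "is_regular \<longleftrightarrow> has_finite_limits \<and>
    (\<forall>f p q. is_kernel_pair f p q \<longrightarrow> (\<exists>e. is_coequalizer p q e)) \<and>
    (\<forall>f g p q. is_pullback f g p q \<and> is_regular_epi g \<longrightarrow> is_regular_epi p)"

definition is_Barr_exact :: bool where
  "is_Barr_exact \<longleftrightarrow> is_regular \<and>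
    (\<forall>d c. is_equivalence_relation d c \<longrightarrow> (\<exists>f. is_kernel_pair f d c))"

definition is_pointed :: bool where
  "is_pointed \<longleftrightarrow> (\<exists>Z. is_zero_object Z)"

definition is_point :: "'a \<Rightarrow> 'a \<Rightarrow> bool" where
  "is_point f s \<longleftrightarrow> f \<in> Arr C \<and> s \<in> Hom C (Cod C f) (Dom C f) \<and> f \<cdot> s = Ident C (Cod C f)"

text \<open>
  Bourn protomodularity: for every arrow \<open>p\<close> the change-of-base functor between the fibres of
  the fibration of points reflects isomorphisms. Here \<open>h\<close> is a morphism of points over \<open>Cod p\<close>,
  and \<open>k\<close> is its pullback along \<open>p\<close>.
\<close>

definition is_protomodular :: bool where
  "is_protomodular \<longleftrightarrow>
    (\<forall>p f s f' s' h a b a' b' k.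
      is_point f s \<and> is_point f' s' \<and>
      h \<in> Hom C (Dom C f) (Dom C f') \<and> f' \<cdot> h = f \<and> h \<cdot> s = s' \<and>
      is_pullback p f a b \<and> is_pullback p f' a' b' \<and>
      k \<in> Hom C (Dom C a) (Dom C a') \<and> a' \<cdot> k = a \<and> b' \<cdot> k = h \<cdot> b \<and> is_iso k
      \<longrightarrow> is_iso h)"

definition has_binary_coproducts :: bool where
  "has_binary_coproducts \<longleftrightarrow>
    (\<forall>X\<in>Obj C. \<forall>Y\<in>Obj C. \<exists>i j. is_coproduct i j \<and> Dom C i = X \<and> Dom C j = Y)"

text \<open>
  \<open>is_flat X Y i j k\<close>: the arrow \<open>k\<close> is the kernel of the arrow induced by the identity of
  \<open>X\<close> and zero on the coproduct of \<open>X\<close> and \<open>Y\<close> with injections \<open>i\<close>, \<open>j\<close>; so \<open>Dom k\<close> is the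
  object \<open>X \<flat> Y\<close>.
\<close>

definition is_flat :: "'o \<Rightarrow> 'o \<Rightarrow> 'a \<Rightarrow> 'a \<Rightarrow> 'a \<Rightarrow> bool" where
  "is_flat X Y i j k \<longleftrightarrow> is_coproduct i j \<and> Dom C i = X \<and> Dom C j = Y \<and>
    (\<exists>r\<in>Hom C (Cod C i) X. r \<cdot> i = Ident C X \<and> is_zero (r \<cdot> j) \<and> is_kernel r k)"

text \<open>The arrow \<open>u = 1\<^sub>X \<flat> f\<close>.\<close>

definition is_flat_map :: "'a \<Rightarrow> 'a \<Rightarrow> 'a \<Rightarrow> 'a \<Rightarrow> 'a \<Rightarrow> 'a \<Rightarrow> 'a \<Rightarrow> 'a \<Rightarrow> bool" where
  "is_flat_map i j k i' j' k' f u \<longleftrightarrow> u \<in> Hom C (Dom C k) (Dom C k') \<and>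
    (\<exists>s\<in>Hom C (Cod C i) (Cod C i'). s \<cdot> i = i' \<and> s \<cdot> j = j' \<cdot> f \<and> k' \<cdot> u = s \<cdot> k)"

definition is_algebraically_coherent :: bool where
  "is_algebraically_coherent \<longleftrightarrow>
    (\<forall>X\<in>Obj C. \<forall>Y\<in>Obj C. \<forall>Z\<in>Obj C.
      \<forall>inY inZ i1 j1 k1 i2 j2 k2 i j k u v a b w.
        is_coproduct inY inZ \<and> Dom C inY = Y \<and> Dom C inZ = Z \<and>
        is_flat X Y i1 j1 k1 \<and> is_flat X Z i2 j2 k2 \<and> is_flat X (Cod C inY) i j k \<and>
        is_flat_map i1 j1 k1 i j k inY u \<and> is_flat_map i2 j2 k2 i j k inZ v \<and>
        is_coproduct a b \<and> Dom C a = Dom C k1 \<and> Dom C b = Dom C k2 \<and>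
        w \<in> Hom C (Cod C a) (Dom C k) \<and> w \<cdot> a = u \<and> w \<cdot> b = v
        \<longrightarrow> is_regular_epi w)"


section \<open>Subobjects and commutators\<close>

definition subobject_le :: "'a \<Rightarrow> 'a \<Rightarrow> bool" where
  "subobject_le a b \<longleftrightarrow> (\<exists>u\<in>Hom C (Dom C a) (Dom C b). b \<cdot> u = a)"

definition is_normal_mono :: "'a \<Rightarrow> bool" where
  "is_normal_mono m \<longleftrightarrow> (\<exists>f. is_kernel f m)"

definition is_image :: "'a \<Rightarrow> 'a \<Rightarrow> bool" where
  "is_image f i \<longleftrightarrow> is_mono i \<and>
    (\<exists>e\<in>Hom C (Dom C f) (Dom C i). is_regular_epi e \<and> i \<cdot> e = f)"

definition is_intersection :: "'a \<Rightarrow> 'a \<Rightarrow> 'a \<Rightarrow> bool" where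
  "is_intersection a b w \<longleftrightarrow> is_mono a \<and> is_mono b \<and> (\<exists>p q. is_pullback a b p q \<and> w = a \<cdot> p)"

definition is_join :: "'a \<Rightarrow> 'a \<Rightarrow> 'a \<Rightarrow> bool" where
  "is_join a b j \<longleftrightarrow> is_mono a \<and> is_mono b \<and> is_mono j \<and> Cod C a = Cod C j \<and> Cod C b = Cod C j \<and>
    subobject_le a j \<and> subobject_le b j \<and>
    (\<forall>x. is_mono x \<and> Cod C x = Cod C j \<and> subobject_le a x \<and> subobject_le b x \<longrightarrow>
      subobject_le j x)"

definition is_normal_closure :: "'a \<Rightarrow> 'a \<Rightarrow> bool" where
  "is_normal_closure a n \<longleftrightarrow> is_mono a \<and> is_normal_mono n \<and> Cod C a = Cod C n \<and>
    subobject_le a n \<and>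
    (\<forall>x. is_normal_mono x \<and> Cod C x = Cod C n \<and> subobject_le a x \<longrightarrow> subobject_le n x)"

definition is_Higgins_commutator :: "'a \<Rightarrow> 'a \<Rightarrow> 'a \<Rightarrow> bool" where
  "is_Higgins_commutator a b c \<longleftrightarrow> is_mono a \<and> is_mono b \<and> Cod C a = Cod C b \<and>
    (\<exists>i j p q r k t.
      is_coproduct i j \<and> Dom C i = Dom C a \<and> Dom C j = Dom C b \<and>
      is_product p q \<and> Cod C p = Dom C a \<and> Cod C q = Dom C b \<and>
      r \<in> Hom C (Cod C i) (Dom C p) \<and>
      p \<cdot> r \<cdot> i = Ident C (Dom C a) \<and> is_zero (p \<cdot> r \<cdot> j) \<and>
      is_zero (q \<cdot> r \<cdot> i) \<and> q \<cdot> r \<cdot> j = Ident C (Dom C b) \<and>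
      is_kernel r k \<and>
      t \<in> Hom C (Cod C i) (Cod C a) \<and> t \<cdot> i = a \<and> t \<cdot> j = b \<and>
      is_image (t \<cdot> k) c)"

definition is_Huq_commutator :: "'a \<Rightarrow> 'a \<Rightarrow> 'a \<Rightarrow> bool" where
  "is_Huq_commutator a b c \<longleftrightarrow> (\<exists>h. is_Higgins_commutator a b h \<and> is_normal_closure h c)"

end

locale semi_abelian_category = category +
  assumes pointed: "is_pointed C"
    and Barr_exact: "is_Barr_exact C"
    and protomodular: "is_protomodular C"
    and binary_coproducts: "has_binary_coproducts C"

locale algebraically_coherent_semi_abelian_category = semi_abelian_category +
  assumes algebraically_coherent: "is_algebraically_coherent C"


section \<open>Internal groupoids and double groupoids\<close>

text \<open>
  \<open>Pr1\<close>, \<open>Pr2\<close> are the projections of the object of composable pairs, i.e. pairs \<open>(x, y)\<close>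
  with the codomain of \<open>x\<close> equal to the domain of \<open>y\<close>.
\<close>

record 'a igpd =
  Src :: 'a
  Tgt :: 'a
  Idn :: 'a
  Pr1 :: 'a
  Pr2 :: 'a
  Mul :: 'a

text \<open>
  In a double groupoid with upper left corner \<open>Q\<close>, right corner \<open>R\<close>, bottom corner \<open>S\<close> and base
  \<open>L\<close>, the four fields are the groupoids \<open>Q \<rightrightarrows> R\<close>, \<open>Q \<rightrightarrows> S\<close>, \<open>R \<rightrightarrows> L\<close> and \<open>S \<rightrightarrows> L\<close>.
\<close>

record 'a dgpd =
  GU :: "'a igpd"
  GL :: "'a igpd"
  GR :: "'a igpd"
  GS :: "'a igpd"

context
  fixes C :: "('o, 'a) cat" (structure)
begin

definition arrows_object :: "'a igpd \<Rightarrow> 'o" where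
  "arrows_object G = Dom C (Src G)"

definition objects_object :: "'a igpd \<Rightarrow> 'o" where
  "objects_object G = Cod C (Src G)"

text \<open>The groupoid axioms are written for generalised elements \<open>x : T \<rightarrow> arrows_object G\<close>.\<close>

definition composable :: "'a igpd \<Rightarrow> 'a \<Rightarrow> 'a \<Rightarrow> bool" where
  "composable G x y \<longleftrightarrow> x \<in> Hom C (Dom C x) (arrows_object G) \<and>
    y \<in> Hom C (Dom C x) (arrows_object G) \<and> Tgt G \<cdot> x = Src G \<cdot> y"

definition gmul :: "'a igpd \<Rightarrow> 'a \<Rightarrow> 'a \<Rightarrow> 'a" where
  "gmul G x y =
    Mul G \<cdot> (THE u. u \<in> Hom C (Dom C x) (Dom C (Pr1 G)) \<and> Pr1 G \<cdot> u = x \<and> Pr2 G \<cdot> u = y)"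

definition is_internal_groupoid :: "'a igpd \<Rightarrow> bool" where
  "is_internal_groupoid G \<longleftrightarrow>
    Src G \<in> Arr C \<and>
    Tgt G \<in> Hom C (arrows_object G) (objects_object G) \<and>
    Idn G \<in> Hom C (objects_object G) (arrows_object G) \<and>
    Src G \<cdot> Idn G = Ident C (objects_object G) \<and>
    Tgt G \<cdot> Idn G = Ident C (objects_object G) \<and>
    is_pullback C (Tgt G) (Src G) (Pr1 G) (Pr2 G) \<and>
    Mul G \<in> Hom C (Dom C (Pr1 G)) (arrows_object G) \<and>
    Src G \<cdot> Mul G = Src G \<cdot> Pr1 G \<and>
    Tgt G \<cdot> Mul G = Tgt G \<cdot> Pr2 G \<and>
    (\<forall>T. \<forall>x\<in>Hom C T (arrows_object G).
      gmul G (Idn G \<cdot> (Src G \<cdot> x)) x = x \<and> gmul G x (Idn G \<cdot> (Tgt G \<cdot> x)) = x) \<and>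
    (\<forall>x y z. composable G x y \<and> composable G y z \<longrightarrow>
      gmul G (gmul G x y) z = gmul G x (gmul G y z)) \<and>
    (\<exists>v\<in>Hom C (arrows_object G) (arrows_object G).
      Src G \<cdot> v = Tgt G \<and> Tgt G \<cdot> v = Src G \<and>
      gmul G (Ident C (arrows_object G)) v = Idn G \<cdot> Src G \<and>
      gmul G v (Ident C (arrows_object G)) = Idn G \<cdot> Tgt G)"

text \<open>\<open>f\<close> and \<open>f0\<close> are the components of the functor on arrows and on objects.\<close>

definition is_internal_functor :: "'a igpd \<Rightarrow> 'a igpd \<Rightarrow> 'a \<Rightarrow> 'a \<Rightarrow> bool" where
  "is_internal_functor G H f f0 \<longleftrightarrow>
    f \<in> Hom C (arrows_object G) (arrows_object H) \<and>
    f0 \<in> Hom C (objects_object G) (objects_object H) \<and>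
    Src H \<cdot> f = f0 \<cdot> Src G \<and> Tgt H \<cdot> f = f0 \<cdot> Tgt G \<and> Idn H \<cdot> f0 = f \<cdot> Idn G \<and>
    (\<forall>x y. composable G x y \<longrightarrow> f \<cdot> gmul G x y = gmul H (f \<cdot> x) (f \<cdot> y))"

definition is_double_groupoid :: "'a dgpd \<Rightarrow> bool" where
  "is_double_groupoid D \<longleftrightarrow>
    is_internal_groupoid (GU D) \<and> is_internal_groupoid (GL D) \<and>
    is_internal_groupoid (GR D) \<and> is_internal_groupoid (GS D) \<and>
    is_internal_functor (GL D) (GR D) (Src (GU D)) (Src (GS D)) \<and>
    is_internal_functor (GL D) (GR D) (Tgt (GU D)) (Tgt (GS D)) \<and>
    is_internal_functor (GR D) (GL D) (Idn (GU D)) (Idn (GS D)) \<and>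
    is_internal_functor (GU D) (GS D) (Src (GL D)) (Src (GR D)) \<and>
    is_internal_functor (GU D) (GS D) (Tgt (GL D)) (Tgt (GR D)) \<and>
    is_internal_functor (GS D) (GU D) (Idn (GL D)) (Idn (GR D)) \<and>
    (\<forall>x y x' y'.
      composable (GU D) x y \<and> composable (GU D) x' y' \<and>
      composable (GL D) x x' \<and> composable (GL D) y y' \<longrightarrow>
      gmul (GL D) (gmul (GU D) x y) (gmul (GU D) x' y') =
      gmul (GU D) (gmul (GL D) x x') (gmul (GL D) y y'))"

definition is_double_functor :: "'a dgpd \<Rightarrow> 'a dgpd \<Rightarrow> 'a \<Rightarrow> 'a \<Rightarrow> 'a \<Rightarrow> 'a \<Rightarrow> bool" where
  "is_double_functor D E g r s l \<longleftrightarrow>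
    is_internal_functor (GU D) (GU E) g r \<and> is_internal_functor (GL D) (GL E) g s \<and>
    is_internal_functor (GR D) (GR E) r l \<and> is_internal_functor (GS D) (GS E) s l"

text \<open>The inclusion of the intersection of the kernels of the two domain morphisms.\<close>

definition is_normalisation :: "'a dgpd \<Rightarrow> 'a \<Rightarrow> bool" where
  "is_normalisation D t \<longleftrightarrow>
    (\<exists>kU kL. is_kernel C (Src (GU D)) kU \<and> is_kernel C (Src (GL D)) kL \<and>
      is_intersection C kU kL t)"


section \<open>The tensor product and the double equivalence relation\<close>

definition is_normal_groupoid :: "'a \<Rightarrow> 'a igpd \<Rightarrow> bool" where
  "is_normal_groupoid m G \<longleftrightarrow> is_normal_mono C m \<and> is_internal_groupoid G \<and>
    (\<exists>q. is_cokernel C m q \<and> is_kernel_pair C q (Src G) (Tgt G))"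

definition is_tensor_double_groupoid :: "'a igpd \<Rightarrow> 'a igpd \<Rightarrow> 'a dgpd \<Rightarrow> bool" where
  "is_tensor_double_groupoid R S D \<longleftrightarrow>
    is_double_groupoid D \<and> GR D = R \<and> GS D = S \<and>
    (\<exists>eU eL dU cU dL cL kdU kcU kdL kcL hU hL j q.
      is_pushout C (Idn R) (Idn S) eU eL \<and>
      dU \<in> Hom C (Cod C eU) (arrows_object R) \<and> cU \<in> Hom C (Cod C eU) (arrows_object R) \<and>
      dL \<in> Hom C (Cod C eU) (arrows_object S) \<and> cL \<in> Hom C (Cod C eU) (arrows_object S) \<and>
      dU \<cdot> eU = Ident C (arrows_object R) \<and> dU \<cdot> eL = Idn R \<cdot> Src S \<and>
      cU \<cdot> eU = Ident C (arrows_object R) \<and> cU \<cdot> eL = Idn R \<cdot> Tgt S \<and>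
      dL \<cdot> eL = Ident C (arrows_object S) \<and> dL \<cdot> eU = Idn S \<cdot> Src R \<and>
      cL \<cdot> eL = Ident C (arrows_object S) \<and> cL \<cdot> eU = Idn S \<cdot> Tgt R \<and>
      is_kernel C dU kdU \<and> is_kernel C cU kcU \<and> is_kernel C dL kdL \<and> is_kernel C cL kcL \<and>
      is_Huq_commutator C kdL kcL hL \<and> is_Huq_commutator C kdU kcU hU \<and>
      is_join C hL hU j \<and> is_cokernel C j q \<and>
      Src (GU D) \<in> Hom C (Cod C q) (arrows_object R) \<and> Src (GU D) \<cdot> q = dU \<and>
      Tgt (GU D) \<in> Hom C (Cod C q) (arrows_object R) \<and> Tgt (GU D) \<cdot> q = cU \<and>
      Src (GL D) \<in> Hom C (Cod C q) (arrows_object S) \<and> Src (GL D) \<cdot> q = dL \<and>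
      Tgt (GL D) \<in> Hom C (Cod C q) (arrows_object S) \<and> Tgt (GL D) \<cdot> q = cL \<and>
      Idn (GU D) = q \<cdot> eU \<and> Idn (GL D) = q \<cdot> eL)"

text \<open>
  The arrows \<open>a\<close>, \<open>b\<close> into \<open>arrows_object R\<close> and \<open>x\<close>, \<open>y\<close> into \<open>arrows_object S\<close>, with common
  domain \<open>T\<close>, form the boundary of a square: \<open>a\<close>, \<open>b\<close> are opposite edges in \<open>R\<close>, and \<open>x\<close>, \<open>y\<close> are
  opposite edges in \<open>S\<close>, from the domains, respectively the codomains, of \<open>a\<close> to those of \<open>b\<close>.
\<close>

definition is_square :: "'a igpd \<Rightarrow> 'a igpd \<Rightarrow> 'o \<Rightarrow> 'a \<Rightarrow> 'a \<Rightarrow> 'a \<Rightarrow> 'a \<Rightarrow> bool" where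
  "is_square R S T a b x y \<longleftrightarrow>
    a \<in> Hom C T (arrows_object R) \<and> b \<in> Hom C T (arrows_object R) \<and>
    x \<in> Hom C T (arrows_object S) \<and> y \<in> Hom C T (arrows_object S) \<and>
    Src R \<cdot> a = Src S \<cdot> x \<and> Src R \<cdot> b = Tgt S \<cdot> x \<and>
    Tgt R \<cdot> a = Src S \<cdot> y \<and> Tgt R \<cdot> b = Tgt S \<cdot> y"

definition is_double_equivalence_relation :: "'a igpd \<Rightarrow> 'a igpd \<Rightarrow> 'a dgpd \<Rightarrow> bool" where
  "is_double_equivalence_relation R S E \<longleftrightarrow>
    is_double_groupoid E \<and> GR E = R \<and> GS E = S \<and>
    is_square R S (arrows_object (GU E)) (Src (GU E)) (Tgt (GU E)) (Src (GL E)) (Tgt (GL E)) \<and>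
    (\<forall>T a b x y. is_square R S T a b x y \<longrightarrow>
      (\<exists>!u. u \<in> Hom C T (arrows_object (GU E)) \<and>
        Src (GU E) \<cdot> u = a \<and> Tgt (GU E) \<cdot> u = b \<and> Src (GL E) \<cdot> u = x \<and> Tgt (GL E) \<cdot> u = y))"

text \<open>
  For normal subobjects \<open>m\<close>, \<open>n\<close> of \<open>L\<close> with intersection \<open>w\<close>: the arrow \<open>h\<close> from the domain of
  \<open>t\<close> (the tensor product) to the domain of \<open>w\<close> (the intersection) is the restriction of the
  morphism of double groupoids \<open>g\<close> to the normalisations. The normalisation \<open>z\<close> of \<open>E\<close> is taken
  with domain the intersection of \<open>m\<close> and \<open>n\<close>; the last corner of the squares in \<open>z\<close> fixes the
  identification.
\<close>

definition is_canonical_map ::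
  "'a dgpd \<Rightarrow> 'a \<Rightarrow> 'a dgpd \<Rightarrow> 'a \<Rightarrow> 'a \<Rightarrow> bool" where
  "is_canonical_map D t E w h \<longleftrightarrow>
    (\<exists>g z.
      is_double_functor D E g (Ident C (arrows_object (GR D))) (Ident C (arrows_object (GS D)))
        (Ident C (objects_object (GR D))) \<and>
      is_normalisation D t \<and> is_normalisation E z \<and> Dom C z = Dom C w \<and>
      Tgt (GR E) \<cdot> (Tgt (GU E) \<cdot> z) = w \<and>
      h \<in> Hom C (Dom C t) (Dom C w) \<and> z \<cdot> h = g \<cdot> t)"

end

end

theory Submission
  imports Defs
begin

text \<open>
  Algebraic coherence makes the kernel functor on points over \<open>L\<close> preserve jointly extremally
  epic pairs. The two degeneracies of the tensor double groupoid form such a pair of morphisms of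
  points over \<open>L\<close>, already because its corner is a quotient of the pushout \<open>Q\<close>; so \<open>M + N\<close> covers the
  kernel \<open>K\<close> of the corner over \<open>L\<close>. The tensor product is the kernel of a map from \<open>K\<close> to
  \<open>M \<times> N\<close>, hence it is covered by the kernel \<open>M \<diamond> N\<close> of \<open>M + N \<rightarrow> M \<times> N\<close>. Reading off the last
  corner of squares shows that the composite from \<open>M \<diamond> N\<close> to \<open>L\<close> is the one whose image is the
  Higgins commutator.
\<close>

text \<open>Coherence speaks only of kernels of the free points \<open>X + Y\<close> over
  \<open>X\<close>. An arbitrary point over \<open>X\<close> with kernel \<open>K\<close> is a
  quotient of the free point on \<open>K\<close>, and the induced action from
  \<open>X \<flat> K\<close> to \<open>K\<close> is a split epimorphism; this carries the property
  from free points over to arbitrary ones. Joint extremality is used in the form that a monomorphism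
  through which both arrows factor is invertible; for a single arrow of a regular category this
  already yields a regular epimorphism. The map from \<open>K\<close> to \<open>M \<times> N\<close>
  is never constructed. Its components after precomposition with
  \<open>M + N \<rightarrow> K\<close> are known, and they suffice to exhibit
  \<open>M \<diamond> N\<close> as the pullback of \<open>M + N \<rightarrow> K\<close> along the
  inclusion of the tensor product, so that pullback stability of regular epimorphisms applies. The
  image is unchanged by precomposition with the resulting cover.\<close>

context category
begin

section \<open>Calculus of typed composites\<close>

lemma Hom_iff [simp]: "f \<in> Hom C X Y \<longleftrightarrow> f \<in> Arr C \<and> Dom C f = X \<and> Cod C f = Y"
  by (auto simp: Hom_def)

lemma Comp_arr [simp]:
  assumes "f \<in> Arr C" "g \<in> Arr C" "Cod C f = Dom C g"
  shows "g \<cdot> f \<in> Arr C" "Dom C (g \<cdot> f) = Dom C f" "Cod C (g \<cdot> f) = Cod C g"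
  using assms Comp_in_Hom[of f "Dom C f" "Cod C f" g "Cod C g"] by auto

lemma Comp_assoc_arr [simp]:
  assumes "f \<in> Arr C" "g \<in> Arr C" "h \<in> Arr C" "Cod C f = Dom C g" "Cod C g = Dom C h"
  shows "(h \<cdot> g) \<cdot> f = h \<cdot> (g \<cdot> f)"
  using assms Comp_assoc[of f "Dom C f" "Cod C f" g "Cod C g" h "Cod C h"] by auto

lemma Ident_arr [simp]:
  assumes "X \<in> Obj C"
  shows "Ident C X \<in> Arr C" "Dom C (Ident C X) = X" "Cod C (Ident C X) = X"
  using Ident_in_Hom[OF assms] by auto

lemma Comp_Ident_arr [simp]: "f \<in> Arr C \<Longrightarrow> Dom C f = X \<Longrightarrow> f \<cdot> Ident C X = f"
  using Comp_Ident[of f X "Cod C f"] by auto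

lemma Ident_Comp_arr [simp]: "f \<in> Arr C \<Longrightarrow> Cod C f = Y \<Longrightarrow> Ident C Y \<cdot> f = f"
  using Ident_Comp[of f "Dom C f" Y] by auto

declare Dom_in_Obj [simp] Cod_in_Obj [simp]

text \<open>Composites are simplified to right-nested form, where \<open>g \<cdot> f\<close> is no
  longer a subterm of \<open>g \<cdot> (f \<cdot> x)\<close>. Instances of this lemma let a known
  equation be applied there.\<close>

lemma Comp_eq_extend:
  assumes "g \<cdot> f = h" "f \<in> Arr C" "g \<in> Arr C" "x \<in> Arr C"
    "Cod C f = Dom C g" "Cod C x = Dom C f"
  shows "g \<cdot> (f \<cdot> x) = h \<cdot> x"
  using assms by (simp flip: Comp_assoc_arr)

lemma is_mono_arr: "is_mono C f \<Longrightarrow> f \<in> Arr C"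
  by (simp add: is_mono_def)

lemma is_mono_cancel:
  assumes "is_mono C f" "f \<cdot> x = f \<cdot> y" "x \<in> Arr C" "y \<in> Arr C"
    "Cod C x = Dom C f" "Cod C y = Dom C f" "Dom C x = Dom C y"
  shows "x = y"
  using assms unfolding is_mono_def by auto

lemma is_mono_right_factor:
  assumes "is_mono C (f \<cdot> g)" "f \<in> Arr C" "g \<in> Arr C" "Cod C g = Dom C f"
  shows "is_mono C g"
  unfolding is_mono_def
proof (intro conjI allI ballI impI)
  fix T x y
  assume x: "x \<in> Hom C T (Dom C g)" and y: "y \<in> Hom C T (Dom C g)" and "g \<cdot> x = g \<cdot> y"
  then have "(f \<cdot> g) \<cdot> x = (f \<cdot> g) \<cdot> y"
    using assms by simp
  then show "x = y"
    by (rule is_mono_cancel[OF assms(1)]) (use x y assms in auto)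
qed (use assms in auto)

lemma split_epi_mono_is_iso:
  assumes "is_mono C i" "s \<in> Arr C" "Dom C s = Cod C i" "Cod C s = Dom C i"
    and "i \<cdot> s = Ident C (Cod C i)"
  shows "is_iso C i"
proof -
  note [simp] = is_mono_arr[OF assms(1)] assms(2-5)
  have "i \<cdot> (s \<cdot> i) = i \<cdot> Ident C (Dom C i)"
    by (simp add: Comp_eq_extend[OF assms(5)])
  then have "s \<cdot> i = Ident C (Dom C i)"
    by (rule is_mono_cancel[OF assms(1)]) auto
  then show ?thesis
    unfolding is_iso_def by (intro conjI bexI[of _ s]) auto
qed


section \<open>Regular epimorphisms\<close>

lemma is_coequalizerD:
  assumes "is_coequalizer C f g q"
  shows "f \<in> Arr C" "g \<in> Arr C" "q \<in> Arr C" "Dom C g = Dom C f" "Cod C g = Cod C f"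
    "Dom C q = Cod C f" "q \<cdot> f = q \<cdot> g"
  using assms unfolding is_coequalizer_def by auto

lemma is_coequalizer_factor:
  assumes "is_coequalizer C f g q" "t \<in> Arr C" "Dom C t = Cod C f" "t \<cdot> f = t \<cdot> g"
  obtains u where "u \<in> Arr C" "Dom C u = Cod C q" "Cod C u = Cod C t" "u \<cdot> q = t"
  using assms unfolding is_coequalizer_def by (metis Hom_iff)

lemma is_regular_epi_arr: "is_regular_epi C q \<Longrightarrow> q \<in> Arr C"
  by (auto simp: is_regular_epi_def is_coequalizer_def)

lemma is_regular_epi_cancel:
  assumes "is_regular_epi C q" "x \<cdot> q = y \<cdot> q" "x \<in> Arr C" "y \<in> Arr C"
    "Dom C x = Cod C q" "Dom C y = Cod C q" "Cod C x = Cod C y"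
  shows "x = y"
proof -
  obtain f g where fg: "is_coequalizer C f g q"
    using assms(1) unfolding is_regular_epi_def by blast
  note [simp] = is_coequalizerD[OF fg] assms(3-7)
  have "\<exists>!u. u \<in> Hom C (Cod C q) (Cod C y) \<and> u \<cdot> q = x \<cdot> q"
  proof -
    have "x \<cdot> q \<in> Hom C (Cod C f) (Cod C y)" "(x \<cdot> q) \<cdot> f = (x \<cdot> q) \<cdot> g"
      by auto
    then show ?thesis
      using fg unfolding is_coequalizer_def by blast
  qed
  then show ?thesis
    using assms by (metis Hom_iff)
qed

text \<open>Diagonal fill-in of a regular epimorphism against a monomorphism: \<open>f\<close>
  identifies the pair that \<open>q\<close> coequalises because this may be tested after the
  monomorphism \<open>i\<close>.\<close>

lemma is_regular_epi_lift:
  assumes q: "is_regular_epi C q" and i: "is_mono C i"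
    and f: "f \<in> Arr C" "Dom C f = Dom C q" "Cod C f = Dom C i"
    and g: "g \<in> Arr C" "Dom C g = Cod C q" "Cod C g = Cod C i"
    and eq: "i \<cdot> f = g \<cdot> q"
  obtains u where "u \<in> Arr C" "Dom C u = Cod C q" "Cod C u = Dom C i" "i \<cdot> u = g" "u \<cdot> q = f"
proof -
  obtain a b where ab: "is_coequalizer C a b q"
    using q unfolding is_regular_epi_def by blast
  note [simp] = is_coequalizerD[OF ab] is_mono_arr[OF i] f g
  have "i \<cdot> (f \<cdot> a) = i \<cdot> (f \<cdot> b)"
    by (simp add: Comp_eq_extend[OF eq])
  then have fab: "f \<cdot> a = f \<cdot> b"
    by (rule is_mono_cancel[OF i]) auto
  obtain u where [simp]: "u \<in> Arr C" "Dom C u = Cod C q" "Cod C u = Cod C f"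
      and u: "u \<cdot> q = f"
    by (rule is_coequalizer_factor[OF ab, of f]; (assumption | simp add: fab))
  have "(i \<cdot> u) \<cdot> q = g \<cdot> q"
    using u eq by simp
  then have "i \<cdot> u = g"
    by (rule is_regular_epi_cancel[OF q]) auto
  with u show thesis
    by (intro that[of u]) auto
qed

text \<open>If \<open>d \<cdot> e\<close> coequalises \<open>a\<close> and \<open>b\<close>, then
  \<open>d\<close> coequalises \<open>e \<cdot> a\<close> and \<open>e \<cdot> b\<close>. The arrow
  \<open>e\<close> need only be cancellable on the right, which is why \<open>epi\<close> is a bare
  cancellation rule.\<close>

lemma is_regular_epi_left_factor:
  assumes de: "is_regular_epi C (d \<cdot> e)"
    and [simp]: "d \<in> Arr C" "e \<in> Arr C" "Cod C e = Dom C d"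
    and epi: "\<And>x y. x \<in> Arr C \<Longrightarrow> y \<in> Arr C \<Longrightarrow> Dom C x = Cod C e \<Longrightarrow> Dom C y = Cod C e \<Longrightarrow>
      Cod C x = Cod C y \<Longrightarrow> x \<cdot> e = y \<cdot> e \<Longrightarrow> x = y"
  shows "is_regular_epi C d"
proof -
  obtain a b where ab: "is_coequalizer C a b (d \<cdot> e)"
    using de unfolding is_regular_epi_def by blast
  note [simp] = is_coequalizerD(1-5)[OF ab]
  have [simp]: "Cod C a = Dom C e"
    using is_coequalizerD(6)[OF ab] by simp
  have "is_coequalizer C (e \<cdot> a) (e \<cdot> b) d"
    unfolding is_coequalizer_def
  proof (intro conjI allI ballI impI)
    fix T t
    assume "t \<in> Hom C (Cod C (e \<cdot> a)) T" and eq: "t \<cdot> (e \<cdot> a) = t \<cdot> (e \<cdot> b)"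
    then have [simp]: "t \<in> Arr C" "Dom C t = Dom C d" "Cod C t = T"
      by auto
    obtain u where [simp]: "u \<in> Arr C" "Dom C u = Cod C (d \<cdot> e)" "Cod C u = Cod C (t \<cdot> e)"
        and u: "u \<cdot> (d \<cdot> e) = t \<cdot> e"
      by (rule is_coequalizer_factor[OF ab, of "t \<cdot> e"]; (assumption | (use eq in simp)))
    have "u \<cdot> d = t"
      by (rule epi) (use u in auto)
    moreover have "v = u" if "v \<in> Hom C (Cod C d) T" "v \<cdot> d = t" for v
    proof (rule is_regular_epi_cancel[OF de])
      show "v \<cdot> (d \<cdot> e) = u \<cdot> (d \<cdot> e)"
        using that u Comp_eq_extend[OF that(2), of e] by simp
    qed (use that in auto)
    ultimately show "\<exists>!u. u \<in> Hom C (Cod C d) T \<and> u \<cdot> d = t"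
      by (intro ex1I[of _ u]) auto
  qed (use is_coequalizerD(7)[OF ab] in auto)
  then show ?thesis
    unfolding is_regular_epi_def by blast
qed

lemma is_regular_epi_iso_Comp:
  assumes q: "is_regular_epi C q" and i: "is_iso C i" and [simp]: "Cod C q = Dom C i"
  shows "is_regular_epi C (i \<cdot> q)"
proof -
  obtain a b where ab: "is_coequalizer C a b q"
    using q unfolding is_regular_epi_def by blast
  obtain v where [simp]: "v \<in> Arr C" "Dom C v = Cod C i" "Cod C v = Dom C i" "i \<in> Arr C"
      and vi: "v \<cdot> i = Ident C (Dom C i)" "i \<cdot> v = Ident C (Cod C i)"
    using i unfolding is_iso_def by auto
  note [simp] = is_coequalizerD[OF ab]
  have "is_coequalizer C a b (i \<cdot> q)"
    unfolding is_coequalizer_def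
  proof (intro conjI allI ballI impI)
    fix T t
    assume "t \<in> Hom C (Cod C a) T" "t \<cdot> a = t \<cdot> b"
    then have [simp]: "t \<in> Arr C" "Dom C t = Cod C a" "Cod C t = T" and eq: "t \<cdot> a = t \<cdot> b"
      by auto
    obtain u where [simp]: "u \<in> Arr C" "Dom C u = Cod C q" "Cod C u = Cod C t" and u: "u \<cdot> q = t"
      by (rule is_coequalizer_factor[OF ab, of t]; (assumption | simp add: eq))
    have "(u \<cdot> v) \<cdot> (i \<cdot> q) = t"
      using Comp_eq_extend[OF vi(1), of q] u by simp
    moreover have "x = u \<cdot> v" if x: "x \<in> Hom C (Cod C (i \<cdot> q)) T" "x \<cdot> (i \<cdot> q) = t" for x
    proof -
      have [simp]: "x \<in> Arr C" "Dom C x = Cod C i" "Cod C x = T"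
        using x by auto
      have "x \<cdot> i = u"
        by (rule is_regular_epi_cancel[OF q]) (use x u in auto)
      then have "x \<cdot> (i \<cdot> v) = u \<cdot> v"
        using Comp_eq_extend[of x i u v] by simp
      then show ?thesis
        using vi by simp
    qed
    ultimately show "\<exists>!u. u \<in> Hom C (Cod C (i \<cdot> q)) T \<and> u \<cdot> (i \<cdot> q) = t"
      by (intro ex1I[of _ "u \<cdot> v"]) auto
  qed auto
  then show ?thesis
    unfolding is_regular_epi_def by blast
qed

section \<open>Pullbacks and image factorisation\<close>

lemma is_pullbackD:
  assumes "is_pullback C f g p q"
  shows "f \<in> Arr C" "g \<in> Arr C" "p \<in> Arr C" "q \<in> Arr C" "Cod C f = Cod C g"
    "Cod C p = Dom C f" "Dom C q = Dom C p" "Cod C q = Dom C g" "f \<cdot> p = g \<cdot> q"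
  using assms unfolding is_pullback_def by auto

lemma is_pullback_factor:
  assumes "is_pullback C f g p q" "x \<in> Arr C" "y \<in> Arr C" "Dom C y = Dom C x"
    "Cod C x = Dom C f" "Cod C y = Dom C g" "f \<cdot> x = g \<cdot> y"
  obtains u where "u \<in> Arr C" "Dom C u = Dom C x" "Cod C u = Dom C p" "p \<cdot> u = x" "q \<cdot> u = y"
  using assms unfolding is_pullback_def by (metis Hom_iff)

lemma is_pullback_jointly_mono:
  assumes pb: "is_pullback C f g p q"
    and xy: "x \<in> Arr C" "y \<in> Arr C" "Dom C x = Dom C y" "Cod C x = Dom C p" "Cod C y = Dom C p"
    and eq: "p \<cdot> x = p \<cdot> y" "q \<cdot> x = q \<cdot> y"
  shows "x = y"
proof -
  note [simp] = is_pullbackD[OF pb] xy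
  have "p \<cdot> x \<in> Hom C (Dom C y) (Dom C f)" "q \<cdot> x \<in> Hom C (Dom C y) (Dom C g)"
    "f \<cdot> (p \<cdot> x) = g \<cdot> (q \<cdot> x)"
    using Comp_eq_extend[OF is_pullbackD(9)[OF pb], of x] by auto
  then have "\<exists>!u. u \<in> Hom C (Dom C y) (Dom C p) \<and> p \<cdot> u = p \<cdot> x \<and> q \<cdot> u = q \<cdot> x"
    using pb unfolding is_pullback_def by blast
  then show ?thesis
    using eq by (metis Hom_iff xy)
qed

lemma is_regular_pullback_exists:
  assumes "is_regular C" "f \<in> Arr C" "g \<in> Arr C" "Cod C f = Cod C g"
  obtains p q where "is_pullback C f g p q"
  using assms unfolding is_regular_def has_finite_limits_def by blast

lemma is_regular_pullback_stable:
  assumes "is_regular C" "is_pullback C f g p q" "is_regular_epi C g"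
  shows "is_regular_epi C p"
  using assms unfolding is_regular_def by blast

text \<open>The cover is the coequaliser of the kernel pair of \<open>f\<close>; the substance is
  that the remaining factor \<open>i\<close> is monic.\<close>

lemma image_factorisation:
  assumes reg: "is_regular C" and f: "f \<in> Arr C"
  obtains i q where "is_mono C i" "is_regular_epi C q" "Dom C q = Dom C f" "Cod C q = Dom C i"
    "Cod C i = Cod C f" "i \<cdot> q = f"
proof -
  obtain p1 p2 where kp: "is_pullback C f f p1 p2"
    by (rule is_regular_pullback_exists[OF reg f f]; (assumption | simp))
  note [simp] = f is_pullbackD(3,4,6-8)[OF kp]
  obtain q where q: "is_coequalizer C p1 p2 q"
    using reg kp unfolding is_regular_def is_kernel_pair_def by blast
  then have rq: "is_regular_epi C q"
    unfolding is_regular_epi_def by blast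
  note [simp] = is_coequalizerD(3,6)[OF q]
  obtain i where [simp]: "i \<in> Arr C" "Dom C i = Cod C q" "Cod C i = Cod C f"
    and i: "i \<cdot> q = f"
    by (rule is_coequalizer_factor[OF q f]; (assumption | (use is_pullbackD(9)[OF kp] in simp)))
  have "is_mono C i"
    unfolding is_mono_def
  proof (intro conjI allI ballI impI)
    fix T x y
    assume "x \<in> Hom C T (Dom C i)" "y \<in> Hom C T (Dom C i)" and eq: "i \<cdot> x = i \<cdot> y"
    then have [simp]: "x \<in> Arr C" "y \<in> Arr C" "Dom C x = T" "Dom C y = T"
        "Cod C x = Cod C q" "Cod C y = Cod C q"
      by auto
    \<comment> \<open>Pulling \<open>q\<close> back along \<open>x\<close>, then along
      \<open>y \<cdot> s\<close>, gives a common cover on which both \<open>x\<close> and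
      \<open>y\<close> lift through \<open>q\<close>. The lifts agree after \<open>f\<close>, so
      they factor through the kernel pair and \<open>q\<close> identifies them; the covers
      \<open>s'\<close> and \<open>s\<close> are then cancelled.\<close>
    obtain s x' where s: "is_pullback C x q s x'"
      by (rule is_regular_pullback_exists[OF reg, of x q]; (assumption | simp))
    note [simp] = is_pullbackD(3-8)[OF s]
    obtain s' y' where s': "is_pullback C (y \<cdot> s) q s' y'"
      by (rule is_regular_pullback_exists[OF reg, of "y \<cdot> s" q]; (assumption | simp))
    note [simp] = is_pullbackD(3-8)[OF s', simplified]
    have xs: "x \<cdot> (s \<cdot> s') = q \<cdot> (x' \<cdot> s')"
      using Comp_eq_extend[OF is_pullbackD(9)[OF s], of s'] by simp
    have ys: "y \<cdot> (s \<cdot> s') = q \<cdot> y'"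
      using is_pullbackD(9)[OF s'] by simp
    have "f \<cdot> (x' \<cdot> s') = i \<cdot> (x \<cdot> (s \<cdot> s'))"
      unfolding xs by (simp add: Comp_eq_extend[OF i])
    also have "\<dots> = i \<cdot> (y \<cdot> (s \<cdot> s'))"
      using Comp_eq_extend[OF eq, of "s \<cdot> s'"] by simp
    also have "\<dots> = f \<cdot> y'"
      unfolding ys by (simp add: Comp_eq_extend[OF i])
    finally have fxy: "f \<cdot> (x' \<cdot> s') = f \<cdot> y'" .
    obtain u where [simp]: "u \<in> Arr C" "Dom C u = Dom C (x' \<cdot> s')"
        "Cod C u = Dom C p1" and u: "p1 \<cdot> u = x' \<cdot> s'" "p2 \<cdot> u = y'"
      by (rule is_pullback_factor[OF kp, of "x' \<cdot> s'" y']; (assumption | simp add: fxy))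
    have "(x \<cdot> s) \<cdot> s' = (y \<cdot> s) \<cdot> s'"
      using xs ys u Comp_eq_extend[OF is_coequalizerD(7)[OF q], of u] by simp
    then have "x \<cdot> s = y \<cdot> s"
      by (rule is_regular_epi_cancel[OF is_regular_pullback_stable[OF reg s' rq]]) auto
    then show "x = y"
      by (rule is_regular_epi_cancel[OF is_regular_pullback_stable[OF reg s rq]]) auto
  qed auto
  then show thesis
    using that rq i by auto
qed

text \<open>The hypothesis makes the monic part of the image factorisation invertible. This is the
  criterion used below whenever no coequalised pair is at hand.\<close>

lemma extremal_epi_is_regular_epi:
  assumes reg: "is_regular C" and f: "f \<in> Arr C"
    and iso: "\<And>i q. is_mono C i \<Longrightarrow> q \<in> Arr C \<Longrightarrow> Dom C q = Dom C f \<Longrightarrow> Cod C q = Dom C i \<Longrightarrow>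
      Cod C i = Cod C f \<Longrightarrow> i \<cdot> q = f \<Longrightarrow> is_iso C i"
  shows "is_regular_epi C f"
proof -
  obtain i q where iq: "is_mono C i" "is_regular_epi C q" "Dom C q = Dom C f" "Cod C q = Dom C i"
      "Cod C i = Cod C f" "i \<cdot> q = f"
    using image_factorisation[OF reg f] .
  then have "is_iso C i"
    using iso is_regular_epi_arr by blast
  then show ?thesis
    using is_regular_epi_iso_Comp iq by metis
qed

text \<open>Coequalised pairs do not compose, so extremality is checked instead: two successive
  fill-ins produce a section of any monomorphism through which the composite factors.\<close>

lemma is_regular_epi_Comp:
  assumes reg: "is_regular C"
    and f: "is_regular_epi C f" and g: "is_regular_epi C g" and [simp]: "Cod C f = Dom C g"
  shows "is_regular_epi C (g \<cdot> f)"
proof (rule extremal_epi_is_regular_epi[OF reg])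
  note [simp] = is_regular_epi_arr[OF f] is_regular_epi_arr[OF g]
  show "g \<cdot> f \<in> Arr C"
    by simp
  fix i q
  assume i: "is_mono C i" and q: "q \<in> Arr C" "Dom C q = Dom C (g \<cdot> f)" "Cod C q = Dom C i"
    and ci: "Cod C i = Cod C (g \<cdot> f)" and iq: "i \<cdot> q = g \<cdot> f"
  note [simp] = is_mono_arr[OF i]
  obtain u where u: "u \<in> Arr C" "Dom C u = Cod C f" "Cod C u = Dom C i" "i \<cdot> u = g"
    by (rule is_regular_epi_lift[OF f i, of q g]; (assumption | (use q ci iq in simp)))
  obtain v where "v \<in> Arr C" "Dom C v = Cod C g" "Cod C v = Dom C i" "i \<cdot> v = Ident C (Cod C g)"
    by (rule is_regular_epi_lift[OF g i, of u "Ident C (Cod C g)"]; (assumption | (use u ci in simp)))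
  then show "is_iso C i"
    using ci by (intro split_epi_mono_is_iso[OF i, of v]) auto
qed


section \<open>Zero arrows, kernels and coproducts\<close>

lemma is_zero_arr: "is_zero C f \<Longrightarrow> f \<in> Arr C"
  by (simp add: is_zero_def)

lemma is_zero_Comp_left:
  assumes "is_zero C f" and [simp]: "g \<in> Arr C" "Cod C f = Dom C g"
  shows "is_zero C (g \<cdot> f)"
proof -
  obtain Z a b where Z: "is_zero_object C Z"
      and [simp]: "a \<in> Arr C" "b \<in> Arr C" "Dom C a = Dom C f" "Cod C a = Z" "Dom C b = Z"
        "Cod C b = Dom C g" and f: "f = b \<cdot> a"
    using assms unfolding is_zero_def by auto
  have "g \<cdot> f = (g \<cdot> b) \<cdot> a"
    unfolding f by simp
  then show ?thesis
    unfolding is_zero_def using Z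
    by (intro conjI exI[of _ Z] exI[of _ a] exI[of _ "g \<cdot> b"]) (simp_all add: is_zero_arr[OF assms(1)])
qed

lemma is_zero_Comp_right:
  assumes "is_zero C g" and [simp]: "f \<in> Arr C" "Cod C f = Dom C g"
  shows "is_zero C (g \<cdot> f)"
proof -
  obtain Z a b where Z: "is_zero_object C Z"
      and [simp]: "a \<in> Arr C" "b \<in> Arr C" "Dom C a = Dom C g" "Cod C a = Z" "Dom C b = Z"
        "Cod C b = Cod C g" and g: "g = b \<cdot> a"
    using assms unfolding is_zero_def by auto
  have "g \<cdot> f = b \<cdot> (a \<cdot> f)"
    unfolding g by simp
  then show ?thesis
    unfolding is_zero_def using Z
    by (intro conjI exI[of _ Z] exI[of _ "a \<cdot> f"] exI[of _ b]) (simp_all add: is_zero_arr[OF assms(1)])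
qed

lemma is_zero_object_unique_to:
  assumes "is_zero_object C Z" "f \<in> Hom C X Z" "g \<in> Hom C X Z"
  shows "f = g"
proof -
  have "X \<in> Obj C"
    using assms(2) by auto
  then show ?thesis
    using assms unfolding is_zero_object_def is_terminal_def by blast
qed

lemma is_zero_object_unique_from:
  assumes "is_zero_object C Z" "f \<in> Hom C Z X" "g \<in> Hom C Z X"
  shows "f = g"
proof -
  have "X \<in> Obj C"
    using assms(2) by auto
  then show ?thesis
    using assms unfolding is_zero_object_def by blast
qed

text \<open>Each zero arrow may pass through its own zero object; the unique arrow \<open>e\<close>
  between the two objects reconciles the factorisations.\<close>

lemma is_zero_unique:
  assumes "is_zero C f" "is_zero C g" "Dom C f = Dom C g" "Cod C f = Cod C g"
  shows "f = g"
proof -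
  obtain Z a b where Z: "is_zero_object C Z" and a: "a \<in> Hom C (Dom C f) Z"
      and b: "b \<in> Hom C Z (Cod C f)" and f: "f = b \<cdot> a"
    using assms(1) unfolding is_zero_def by blast
  obtain Z' a' b' where Z': "is_zero_object C Z'" and a': "a' \<in> Hom C (Dom C g) Z'"
      and b': "b' \<in> Hom C Z' (Cod C g)" and g: "g = b' \<cdot> a'"
    using assms(2) unfolding is_zero_def by blast
  have "Z \<in> Obj C"
    using Z unfolding is_zero_object_def is_terminal_def by blast
  then obtain e where e: "e \<in> Hom C Z Z'"
    using Z' unfolding is_zero_object_def is_terminal_def by blast
  have "e \<cdot> a = a'"
    using is_zero_object_unique_to[OF Z' Comp_in_Hom[OF a e]] a' assms(3) by simp
  moreover have "b' \<cdot> e = b"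
    using is_zero_object_unique_from[OF Z Comp_in_Hom[OF e b']] b assms(4) by simp
  ultimately show ?thesis
    using Comp_assoc[OF a e b'] f g by metis
qed

lemma is_zero_exists:
  assumes "is_pointed C" "X \<in> Obj C" "Y \<in> Obj C"
  obtains z where "is_zero C z" "z \<in> Arr C" "Dom C z = X" "Cod C z = Y"
proof -
  obtain Z where Z: "is_zero_object C Z"
    using assms(1) unfolding is_pointed_def by blast
  then obtain a b where ab: "a \<in> Hom C X Z" "b \<in> Hom C Z Y"
    using assms(2,3) unfolding is_zero_object_def is_terminal_def by blast
  have "is_zero C (b \<cdot> a)"
    unfolding is_zero_def using Z ab
    by (intro conjI exI[of _ Z] exI[of _ a] exI[of _ b]) auto
  with ab show thesis
    by (intro that[of "b \<cdot> a"]) auto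
qed

lemma is_zero_mono_reflect:
  assumes p: "is_pointed C" and m: "is_mono C m" and z: "is_zero C (m \<cdot> x)"
    and [simp]: "x \<in> Arr C" "Cod C x = Dom C m"
  shows "is_zero C x"
proof -
  note [simp] = is_mono_arr[OF m]
  obtain o' where o': "is_zero C o'" and [simp]: "o' \<in> Arr C" "Dom C o' = Dom C x"
      "Cod C o' = Dom C m"
    by (rule is_zero_exists[OF p, of "Dom C x" "Dom C m"]; (assumption | simp))
  have "m \<cdot> o' = m \<cdot> x"
    by (rule is_zero_unique) (use z is_zero_Comp_left[OF o', of m] in auto)
  then have "o' = x"
    by (rule is_mono_cancel[OF m]) auto
  with o' show ?thesis
    by simp
qed

lemma is_kernelD:
  assumes "is_kernel C f k"
  shows "f \<in> Arr C" "k \<in> Arr C" "Cod C k = Dom C f" "is_zero C (f \<cdot> k)"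
  using assms unfolding is_kernel_def by auto

lemma is_kernel_factor:
  assumes "is_kernel C f k" "t \<in> Arr C" "Cod C t = Dom C f" "is_zero C (f \<cdot> t)"
  obtains u where "u \<in> Arr C" "Dom C u = Dom C t" "Cod C u = Dom C k" "k \<cdot> u = t"
  using assms unfolding is_kernel_def by (metis Hom_iff)

lemma is_kernel_is_mono:
  assumes k: "is_kernel C f k"
  shows "is_mono C k"
  unfolding is_mono_def
proof (intro conjI allI ballI impI)
  fix T x y
  assume x: "x \<in> Hom C T (Dom C k)" and y: "y \<in> Hom C T (Dom C k)" and eq: "k \<cdot> x = k \<cdot> y"
  have "k \<cdot> x \<in> Hom C T (Dom C f)"
    using x is_kernelD[OF k] by simp
  moreover have "is_zero C (f \<cdot> (k \<cdot> x))"
    using is_zero_Comp_right[OF is_kernelD(4)[OF k], of x] x is_kernelD(1-3)[OF k] by simp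
  ultimately show "x = y"
    using k x y eq unfolding is_kernel_def by metis
qed (use is_kernelD[OF k] in auto)

text \<open>Protomodularity is phrased with pullbacks of points; this presents kernels as pullbacks
  along the arrow from a zero object.\<close>

lemma is_kernel_pullback:
  assumes k: "is_kernel C f k" and Z: "is_zero_object C Z"
    and z: "z \<in> Hom C Z (Cod C f)" and o': "o' \<in> Hom C (Dom C k) Z"
  shows "is_pullback C z f o' k"
  unfolding is_pullback_def
proof (intro conjI allI ballI impI)
  note [simp] = is_kernelD(1-3)[OF k]
  have zero: "is_zero C (z \<cdot> x)" if "x \<in> Hom C T Z" for x T
    unfolding is_zero_def using Z z that
    by (intro conjI exI[of _ Z] exI[of _ x] exI[of _ z]) auto
  show "z \<cdot> o' = f \<cdot> k"
    by (rule is_zero_unique) (use zero[OF o'] is_kernelD(4)[OF k] z o' in auto)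
  fix T x y
  assume x: "x \<in> Hom C T (Dom C z)" and y: "y \<in> Hom C T (Dom C f)" and eq: "z \<cdot> x = f \<cdot> y"
  then have "is_zero C (f \<cdot> y)"
    using zero[of x T] z by simp
  then have "\<exists>!u. u \<in> Hom C T (Dom C k) \<and> k \<cdot> u = y"
    using k y unfolding is_kernel_def by blast
  then obtain u where u: "u \<in> Hom C T (Dom C k)" "k \<cdot> u = y"
      and unique: "\<And>v. v \<in> Hom C T (Dom C k) \<Longrightarrow> k \<cdot> v = y \<Longrightarrow> v = u"
    by blast
  have "o' \<cdot> u = x"
    by (rule is_zero_object_unique_to[OF Z Comp_in_Hom[OF u(1) o']]) (use x z in auto)
  moreover have "u \<in> Hom C T (Dom C o')"
    using u(1) o' by simp
  moreover have "v = u" if "v \<in> Hom C T (Dom C o')" "k \<cdot> v = y" for v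
    by (rule unique) (use that o' in simp_all)
  ultimately show "\<exists>!u. u \<in> Hom C T (Dom C o') \<and> o' \<cdot> u = x \<and> k \<cdot> u = y"
    using u(2) by blast
qed (use is_kernelD[OF k] z o' in auto)

text \<open>An element of \<open>Dom C f\<close> whose image lies in the kernel of \<open>g\<close>
  is killed by \<open>g \<cdot> f\<close>. As the square is a pullback, a regular epimorphism
  \<open>f\<close> over a common base restricts to a regular epimorphism of kernels.\<close>

lemma kernel_restriction_is_pullback:
  assumes \<kappa>: "is_kernel C g \<kappa>" and k: "is_kernel C (g \<cdot> f) k"
    and [simp]: "f \<in> Arr C" "Cod C f = Dom C g"
    and [simp]: "f' \<in> Arr C" "Dom C f' = Dom C k" "Cod C f' = Dom C \<kappa>"
    and eq: "\<kappa> \<cdot> f' = f \<cdot> k"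
  shows "is_pullback C \<kappa> f f' k"
  unfolding is_pullback_def
proof (intro conjI allI ballI impI)
  note [simp] = is_kernelD(1-3)[OF \<kappa>]
  have [simp]: "k \<in> Arr C" "Cod C k = Dom C f"
    using is_kernelD[OF k] by simp_all
  fix T x y
  assume x: "x \<in> Hom C T (Dom C \<kappa>)" and y: "y \<in> Hom C T (Dom C f)" and xy: "\<kappa> \<cdot> x = f \<cdot> y"
  have "is_zero C ((g \<cdot> \<kappa>) \<cdot> x)"
    by (rule is_zero_Comp_right) (use is_kernelD(4)[OF \<kappa>] x in auto)
  moreover have "(g \<cdot> \<kappa>) \<cdot> x = (g \<cdot> f) \<cdot> y"
    using x y xy by simp
  ultimately have zero: "is_zero C ((g \<cdot> f) \<cdot> y)"
    by simp
  obtain u where u: "u \<in> Arr C" "Dom C u = Dom C y" "Cod C u = Dom C k" "k \<cdot> u = y"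
    by (rule is_kernel_factor[OF k, of y]; (assumption | (use y zero in simp)))
  have "\<kappa> \<cdot> (f' \<cdot> u) = \<kappa> \<cdot> x"
    using Comp_eq_extend[OF eq, of u] u xy by simp
  then have "f' \<cdot> u = x"
    by (rule is_mono_cancel[OF is_kernel_is_mono[OF \<kappa>]]) (use x y u in auto)
  moreover have "v = u" if "v \<in> Hom C T (Dom C f')" "k \<cdot> v = y" for v
    by (rule is_mono_cancel[OF is_kernel_is_mono[OF k]]) (use that u y in auto)
  moreover have "u \<in> Hom C T (Dom C f')"
    using u(1-3) y by simp
  ultimately show "\<exists>!u. u \<in> Hom C T (Dom C f') \<and> f' \<cdot> u = x \<and> k \<cdot> u = y"
    using u(4) by blast
qed (use is_kernelD[OF k] is_kernelD[OF \<kappa>] eq in auto)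

lemma is_coproductD:
  assumes "is_coproduct C i j"
  shows "i \<in> Arr C" "j \<in> Arr C" "Cod C j = Cod C i"
  using assms unfolding is_coproduct_def by auto

lemma is_coproduct_factor:
  assumes "is_coproduct C i j" "x \<in> Arr C" "y \<in> Arr C" "Dom C x = Dom C i" "Dom C y = Dom C j"
    "Cod C y = Cod C x"
  obtains u where "u \<in> Arr C" "Dom C u = Cod C i" "Cod C u = Cod C x" "u \<cdot> i = x" "u \<cdot> j = y"
  using assms unfolding is_coproduct_def by (metis Hom_iff)

lemma is_coproduct_jointly_epi:
  assumes ij: "is_coproduct C i j"
    and xy: "x \<in> Arr C" "y \<in> Arr C" "Dom C x = Cod C i" "Dom C y = Cod C i" "Cod C x = Cod C y"
    and eq: "x \<cdot> i = y \<cdot> i" "x \<cdot> j = y \<cdot> j"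
  shows "x = y"
proof -
  note [simp] = is_coproductD[OF ij] xy
  have "x \<cdot> i \<in> Hom C (Dom C i) (Cod C y)" "x \<cdot> j \<in> Hom C (Dom C j) (Cod C y)"
    by auto
  then have "\<exists>!u. u \<in> Hom C (Cod C i) (Cod C y) \<and> u \<cdot> i = x \<cdot> i \<and> u \<cdot> j = x \<cdot> j"
    using ij unfolding is_coproduct_def by blast
  then show ?thesis
    using eq by (metis Hom_iff xy)
qed

end


section \<open>Kernels of points\<close>

lemma (in category) is_pointD:
  assumes "is_point C f s"
  shows "f \<in> Arr C" "s \<in> Arr C" "Dom C s = Cod C f" "Cod C s = Dom C f"
    "f \<cdot> s = Ident C (Cod C f)"
  using assms unfolding is_point_def by auto

context semi_abelian_category
begin

lemma regular: "is_regular C"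
  using Barr_exact by (simp add: is_Barr_exact_def)

lemma kernel_exists:
  assumes f: "f \<in> Arr C"
  obtains k where "is_kernel C f k"
proof -
  obtain Z where Z: "is_zero_object C Z"
    using pointed unfolding is_pointed_def by blast
  obtain z where z: "z \<in> Hom C Z (Cod C f)"
    using Z f unfolding is_zero_object_def by (meson Cod_in_Obj)
  obtain o' k where pb: "is_pullback C z f o' k"
    by (rule is_regular_pullback_exists[OF regular, of z f]; (assumption | (use z f in simp)))
  note [simp] = is_pullbackD(3,4,6-8)[OF pb]
  have [simp]: "z \<in> Arr C" "Dom C z = Z" "Cod C z = Cod C f"
    using z by auto
  note f [simp]
  have "is_kernel C f k"
    unfolding is_kernel_def
  proof (intro conjI allI ballI impI)
    show "is_zero C (f \<cdot> k)"
      unfolding is_zero_def using Z is_pullbackD(9)[OF pb]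
      by (intro conjI exI[of _ Z] exI[of _ o'] exI[of _ z]) auto
    fix T t
    assume t: "t \<in> Hom C T (Dom C f)" and zero: "is_zero C (f \<cdot> t)"
    have "T \<in> Obj C"
      using t by auto
    then obtain x where x: "x \<in> Hom C T Z"
      using Z unfolding is_zero_object_def is_terminal_def by blast
    have "is_zero C (z \<cdot> x)"
      unfolding is_zero_def using Z z x
      by (intro conjI exI[of _ Z] exI[of _ x] exI[of _ z]) auto
    then have eq: "z \<cdot> x = f \<cdot> t"
      by (rule is_zero_unique) (use zero x t in auto)
    obtain u where u: "u \<in> Arr C" "Dom C u = Dom C x" "Cod C u = Dom C o'" "o' \<cdot> u = x" "k \<cdot> u = t"
      by (rule is_pullback_factor[OF pb, of x t]; (assumption | (use x t eq in simp)))
    show "\<exists>!u. u \<in> Hom C T (Dom C k) \<and> k \<cdot> u = t"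
    proof (rule ex1I[of _ u])
      fix v
      assume v: "v \<in> Hom C T (Dom C k) \<and> k \<cdot> v = t"
      have "o' \<cdot> v \<in> Hom C T Z" "o' \<cdot> u \<in> Hom C T Z"
        using u v x by auto
      then have "o' \<cdot> v = o' \<cdot> u"
        by (rule is_zero_object_unique_to[OF Z])
      then show "v = u"
        by (rule is_pullback_jointly_mono[OF pb, rotated 5]) (use u v x in auto)
    qed (use u x in auto)
  qed auto
  then show thesis
    using that by blast
qed

text \<open>The section and the kernel of a point are jointly extremally epic. On kernels,
  \<open>i\<close> restricts to a monomorphism \<open>j\<close> that is split because
  \<open>k\<close> factors through \<open>i\<close>; protomodularity reflects the invertibility of
  \<open>j\<close> to \<open>i\<close>.\<close>

lemma point_mono_is_iso:
  assumes pt: "is_point C f s" and k: "is_kernel C f k" and i: "is_mono C i"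
    and [simp]: "Cod C i = Dom C f"
    and [simp]: "s' \<in> Arr C" "Dom C s' = Cod C f" "Cod C s' = Dom C i" and s': "i \<cdot> s' = s"
    and [simp]: "k' \<in> Arr C" "Dom C k' = Dom C k" "Cod C k' = Dom C i" and k': "i \<cdot> k' = k"
  shows "is_iso C i"
proof -
  note [simp] = is_pointD[OF pt] is_kernelD(2,3)[OF k] is_mono_arr[OF i]
  obtain \<kappa> where \<kappa>: "is_kernel C (f \<cdot> i) \<kappa>"
    by (rule kernel_exists[of "f \<cdot> i"]; (assumption | simp))
  have [simp]: "\<kappa> \<in> Arr C" "Cod C \<kappa> = Dom C i"
    using is_kernelD[OF \<kappa>] by simp_all
  have i\<kappa>: "is_zero C (f \<cdot> (i \<cdot> \<kappa>))"
    using is_kernelD(4)[OF \<kappa>] by simp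
  obtain j where [simp]: "j \<in> Arr C" "Dom C j = Dom C (i \<cdot> \<kappa>)" "Cod C j = Dom C k"
      and j: "k \<cdot> j = i \<cdot> \<kappa>"
    by (rule is_kernel_factor[OF k, of "i \<cdot> \<kappa>"]; (assumption | simp add: i\<kappa>))
  have mono_k: "is_mono C k" and mono_\<kappa>: "is_mono C \<kappa>"
    using k \<kappa> is_kernel_is_mono by blast+
  have "is_mono C j"
    unfolding is_mono_def
  proof (intro conjI allI ballI impI)
    fix T x y
    assume "x \<in> Hom C T (Dom C j)" "y \<in> Hom C T (Dom C j)" and eq: "j \<cdot> x = j \<cdot> y"
    then have [simp]: "x \<in> Arr C" "y \<in> Arr C" "Dom C x = T" "Dom C y = T" "Cod C x = Dom C \<kappa>"
        "Cod C y = Dom C \<kappa>"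
      by auto
    have "i \<cdot> (\<kappa> \<cdot> x) = i \<cdot> (\<kappa> \<cdot> y)"
      using Comp_eq_extend[OF j, of x] Comp_eq_extend[OF j, of y] eq by simp
    then have "\<kappa> \<cdot> x = \<kappa> \<cdot> y"
      by (rule is_mono_cancel[OF i]) auto
    then show "x = y"
      by (rule is_mono_cancel[OF mono_\<kappa>]) auto
  qed auto
  moreover
  have zk': "is_zero C ((f \<cdot> i) \<cdot> k')"
    using is_kernelD(4)[OF k] k' by simp
  obtain v where [simp]: "v \<in> Arr C" "Dom C v = Dom C k'" "Cod C v = Dom C \<kappa>" and v: "\<kappa> \<cdot> v = k'"
    by (rule is_kernel_factor[OF \<kappa>, of k']; (assumption | simp add: zk' del: Comp_assoc_arr))
  have "k \<cdot> (j \<cdot> v) = k \<cdot> Ident C (Dom C k)"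
    using Comp_eq_extend[OF j, of v] v k' by simp
  then have "j \<cdot> v = Ident C (Dom C k)"
    by (rule is_mono_cancel[OF mono_k]) auto
  ultimately have iso: "is_iso C j"
    by (intro split_epi_mono_is_iso[of j v]) auto
  \<comment> \<open>Protomodularity is applied to the change of base along \<open>z : 0 \<rightarrow> Cod C f\<close>, which takes kernels.\<close>
  obtain Z where Z: "is_zero_object C Z"
    using pointed unfolding is_pointed_def by blast
  obtain z where z: "z \<in> Hom C Z (Cod C f)"
    using Z unfolding is_zero_object_def by (meson Cod_in_Obj is_pointD(1)[OF pt])
  obtain a a' where a: "a \<in> Hom C (Dom C \<kappa>) Z" and a': "a' \<in> Hom C (Dom C k) Z"
    using Z unfolding is_zero_object_def is_terminal_def
    by (meson Dom_in_Obj is_kernelD(2)[OF k] is_kernelD(2)[OF \<kappa>])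
  have "is_pullback C z (f \<cdot> i) a \<kappa>" "is_pullback C z f a' k"
    using is_kernel_pullback[OF \<kappa> Z] is_kernel_pullback[OF k Z] z a a' by auto
  moreover have "a' \<cdot> j = a"
    by (rule is_zero_object_unique_to[OF Z _ a]) (use a' in auto)
  moreover have "is_point C (f \<cdot> i) s'"
    using s' by (simp add: is_point_def)
  ultimately show ?thesis
    using protomodular[unfolded is_protomodular_def, rule_format,
        of "f \<cdot> i" s' f s i z a \<kappa> a' k j] pt iso j s' a a' by auto
qed

lemma point_coproduct_regular_epi:
  assumes pt: "is_point C f s" and k: "is_kernel C f k" and ij: "is_coproduct C i j"
    and [simp]: "Dom C i = Cod C f" "Dom C j = Dom C k"
    and [simp]: "\<phi> \<in> Arr C" "Dom C \<phi> = Cod C i" "Cod C \<phi> = Dom C f"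
    and \<phi>: "\<phi> \<cdot> i = s" "\<phi> \<cdot> j = k"
  shows "is_regular_epi C \<phi>"
proof (rule extremal_epi_is_regular_epi[OF regular])
  note [simp] = is_coproductD[OF ij]
  fix i' q
  assume i': "is_mono C i'" and q: "q \<in> Arr C" "Dom C q = Dom C \<phi>" "Cod C q = Dom C i'"
    "Cod C i' = Cod C \<phi>" "i' \<cdot> q = \<phi>"
  show "is_iso C i'"
    by (rule point_mono_is_iso[OF pt k i', of "q \<cdot> i" "q \<cdot> j"])
      (use q \<phi> is_mono_arr[OF i'] Comp_eq_extend[OF q(5)] in simp_all)
qed auto

lemma flat_exists:
  assumes [simp]: "X \<in> Obj C" "Y \<in> Obj C"
  obtains i j r l where "is_coproduct C i j" "Dom C i = X" "Dom C j = Y"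
    "r \<in> Arr C" "Dom C r = Cod C i" "Cod C r = X" "r \<cdot> i = Ident C X" "is_zero C (r \<cdot> j)"
    "is_kernel C r l" "is_flat C X Y i j l"
proof -
  obtain i j where ij: "is_coproduct C i j" and [simp]: "Dom C i = X" "Dom C j = Y"
    using binary_coproducts assms unfolding has_binary_coproducts_def by blast
  note [simp] = is_coproductD[OF ij]
  obtain z where z: "is_zero C z" and [simp]: "z \<in> Arr C" "Dom C z = Y" "Cod C z = X"
    by (rule is_zero_exists[OF pointed, of Y X]; (assumption | simp))
  obtain r where r: "r \<in> Arr C" "Dom C r = Cod C i" "Cod C r = Cod C (Ident C X)"
      "r \<cdot> i = Ident C X" "r \<cdot> j = z"
    by (rule is_coproduct_factor[OF ij, of "Ident C X" z]; (assumption | simp))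
  obtain l where l: "is_kernel C r l"
    using kernel_exists r(1) by blast
  have "is_flat C X Y i j l"
    unfolding is_flat_def using ij r l z by auto
  then show thesis
    using that[of i j r l] ij r l z by simp
qed

text \<open>The arrow \<open>s\<close>, which is the identity of \<open>X\<close> plus
  \<open>f\<close>, commutes with the retractions \<open>r\<close> and \<open>r'\<close> onto
  \<open>X\<close>, and so it restricts to their kernels.\<close>

lemma flat_map_exists:
  assumes ij: "is_coproduct C i j" and [simp]: "r \<in> Arr C" "Dom C r = Cod C i" "Cod C r = X"
    and r: "r \<cdot> i = Ident C X" "is_zero C (r \<cdot> j)" and l: "is_kernel C r l"
    and ij': "is_coproduct C i' j'" and [simp]: "r' \<in> Arr C" "Dom C r' = Cod C i'" "Cod C r' = X"
    and r': "r' \<cdot> i' = Ident C X" "is_zero C (r' \<cdot> j')" and l': "is_kernel C r' l'"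
    and [simp]: "Dom C i' = Dom C i" "f \<in> Arr C" "Dom C f = Dom C j" "Cod C f = Dom C j'"
  obtains s u where "s \<in> Arr C" "Dom C s = Cod C i" "Cod C s = Cod C i'"
    "s \<cdot> i = i'" "s \<cdot> j = j' \<cdot> f"
    "u \<in> Arr C" "Dom C u = Dom C l" "Cod C u = Dom C l'" "l' \<cdot> u = s \<cdot> l"
    "is_flat_map C i j l i' j' l' f u"
proof -
  note [simp] = is_coproductD[OF ij] is_coproductD[OF ij'] is_kernelD(1-3)[OF l]
    is_kernelD(1-3)[OF l']
  obtain s where s [simp]: "s \<in> Arr C" "Dom C s = Cod C i" "Cod C s = Cod C i'"
      and si: "s \<cdot> i = i'" "s \<cdot> j = j' \<cdot> f"
    by (rule is_coproduct_factor[OF ij, of i' "j' \<cdot> f"]; (assumption | simp))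
  have r's: "r' \<cdot> s = r"
  proof (rule is_coproduct_jointly_epi[OF ij])
    have "is_zero C ((r' \<cdot> j') \<cdot> f)"
      by (rule is_zero_Comp_right[OF r'(2)]) auto
    then show "(r' \<cdot> s) \<cdot> j = r \<cdot> j"
      using r si by (intro is_zero_unique) auto
  qed (use si r r' in auto)
  have zero: "is_zero C (r' \<cdot> (s \<cdot> l))"
    using is_kernelD(4)[OF l] by (simp add: Comp_eq_extend[OF r's])
  obtain u where u: "u \<in> Arr C" "Dom C u = Dom C (s \<cdot> l)" "Cod C u = Dom C l'" "l' \<cdot> u = s \<cdot> l"
    by (rule is_kernel_factor[OF l', of "s \<cdot> l"]; (assumption | simp add: zero))
  have "is_flat_map C i j l i' j' l' f u"
    unfolding is_flat_map_def by (intro conjI bexI[of _ s]) (use u si in simp_all)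
  then show thesis
    using that[of s u] u s si by simp
qed

text \<open>Here \<open>\<xi>\<close> is the action of \<open>Cod C d\<close> on the kernel \<open>k\<close>, defined on \<open>Dom C l = Cod C d \<flat> Dom C k\<close>.\<close>

lemma point_action_split_epi:
  assumes pt: "is_point C d s" and k: "is_kernel C d k"
    and ij: "is_coproduct C i j" and [simp]: "Dom C i = Cod C d" "Dom C j = Dom C k"
    and [simp]: "r \<in> Arr C" "Dom C r = Cod C i" "Cod C r = Cod C d"
    and r: "r \<cdot> i = Ident C (Cod C d)" "is_zero C (r \<cdot> j)" and l: "is_kernel C r l"
  obtains \<phi> \<xi> \<eta> where "is_regular_epi C \<phi>" "Dom C \<phi> = Cod C i" "Cod C \<phi> = Dom C d"
    "\<phi> \<cdot> i = s" "\<phi> \<cdot> j = k"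
    "\<xi> \<in> Arr C" "Dom C \<xi> = Dom C l" "Cod C \<xi> = Dom C k" "k \<cdot> \<xi> = \<phi> \<cdot> l"
    "\<eta> \<in> Arr C" "Dom C \<eta> = Dom C k" "Cod C \<eta> = Dom C l" "\<xi> \<cdot> \<eta> = Ident C (Dom C k)"
proof -
  note [simp] = is_pointD[OF pt] is_coproductD[OF ij] is_kernelD(2,3)[OF k] is_kernelD(2,3)[OF l]
  obtain \<phi> where \<phi> [simp]: "\<phi> \<in> Arr C" "Dom C \<phi> = Cod C i" "Cod C \<phi> = Cod C s"
      and \<phi>ij: "\<phi> \<cdot> i = s" "\<phi> \<cdot> j = k"
    by (rule is_coproduct_factor[OF ij, of s k]; (assumption | simp))
  have "is_regular_epi C \<phi>"
    by (rule point_coproduct_regular_epi[OF pt k ij]) (use \<phi>ij in auto)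
  have d\<phi>: "d \<cdot> \<phi> = r"
  proof (rule is_coproduct_jointly_epi[OF ij])
    show "(d \<cdot> \<phi>) \<cdot> j = r \<cdot> j"
      using r(2) \<phi>ij is_kernelD(4)[OF k] by (intro is_zero_unique) auto
  qed (use r \<phi>ij in auto)
  have zero: "is_zero C (d \<cdot> (\<phi> \<cdot> l))"
    using is_kernelD(4)[OF l] by (simp add: Comp_eq_extend[OF d\<phi>])
  obtain \<xi> where \<xi> [simp]: "\<xi> \<in> Arr C" "Dom C \<xi> = Dom C (\<phi> \<cdot> l)" "Cod C \<xi> = Dom C k"
      and k\<xi>: "k \<cdot> \<xi> = \<phi> \<cdot> l"
    by (rule is_kernel_factor[OF k, of "\<phi> \<cdot> l"]; (assumption | simp add: zero))
  \<comment> \<open>The injection \<open>j\<close> is killed by \<open>r\<close>, so it factors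
    through \<open>l\<close>. The resulting \<open>\<eta>\<close> is the unit, and
    \<open>\<xi> \<cdot> \<eta> = 1\<close> is the unit law of the action.\<close>
  obtain \<eta> where \<eta> [simp]: "\<eta> \<in> Arr C" "Dom C \<eta> = Dom C j" "Cod C \<eta> = Dom C l"
      and l\<eta>: "l \<cdot> \<eta> = j"
    by (rule is_kernel_factor[OF l, of j]; (assumption | simp add: r))
  have "k \<cdot> (\<xi> \<cdot> \<eta>) = k \<cdot> Ident C (Dom C k)"
    using l\<eta> \<phi>ij by (simp add: Comp_eq_extend[OF k\<xi>])
  then have "\<xi> \<cdot> \<eta> = Ident C (Dom C k)"
    by (rule is_mono_cancel[OF is_kernel_is_mono[OF k]]) auto
  then show thesis
    using that[of \<phi> \<xi> \<eta>] \<open>is_regular_epi C \<phi>\<close> \<phi>ij k\<xi> by simp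
qed

end

section \<open>Algebraic coherence for arbitrary points\<close>

context algebraically_coherent_semi_abelian_category
begin

text \<open>
  The arrow \<open>X + (Dom C k1 + Dom C k2) \<rightarrow> Dom C d\<close> is a regular epimorphism, so its restriction \<open>\<phi>'\<close>
  to kernels is one too. Precomposed with the coherence epimorphism \<open>w\<close> it factors through \<open>\<psi>\<close> by
  means of the actions \<open>\<xi>1\<close> and \<open>\<xi>2\<close>, which are split epimorphisms.
\<close>

lemma point_kernels_regular_epi:
  assumes pt1: "is_point C d1 s1" and k1: "is_kernel C d1 k1"
    and pt2: "is_point C d2 s2" and k2: "is_kernel C d2 k2"
    and pt: "is_point C d s" and \<kappa>: "is_kernel C d \<kappa>"
    and [simp]: "Cod C d1 = Cod C d" "Cod C d2 = Cod C d"
    and [simp]: "a \<in> Arr C" "Dom C a = Dom C d1" "Cod C a = Dom C d"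
    and [simp]: "b \<in> Arr C" "Dom C b = Dom C d2" "Cod C b = Dom C d"
    and as: "a \<cdot> s1 = s" and bs: "b \<cdot> s2 = s"
    and extremal: "\<And>i x y. is_mono C i \<Longrightarrow> Cod C i = Dom C d \<Longrightarrow>
      x \<in> Arr C \<Longrightarrow> Cod C x = Dom C i \<Longrightarrow> i \<cdot> x = a \<Longrightarrow>
      y \<in> Arr C \<Longrightarrow> Cod C y = Dom C i \<Longrightarrow> i \<cdot> y = b \<Longrightarrow> is_iso C i"
    and in12: "is_coproduct C in1 in2" and [simp]: "Dom C in1 = Dom C k1" "Dom C in2 = Dom C k2"
    and [simp]: "\<psi> \<in> Arr C" "Dom C \<psi> = Cod C in1" "Cod C \<psi> = Dom C \<kappa>"
    and \<psi>1: "\<kappa> \<cdot> (\<psi> \<cdot> in1) = a \<cdot> k1" and \<psi>2: "\<kappa> \<cdot> (\<psi> \<cdot> in2) = b \<cdot> k2"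
  shows "is_regular_epi C \<psi>"
proof -
  define X where "X = Cod C d"
  note [simp] = is_pointD[OF pt1] is_pointD[OF pt2] is_pointD[OF pt] X_def[symmetric]
    is_kernelD(2,3)[OF k1] is_kernelD(2,3)[OF k2] is_kernelD(2,3)[OF \<kappa>] is_coproductD[OF in12]
  have [simp]: "X \<in> Obj C"
    using Cod_in_Obj[OF is_pointD(1)[OF pt]] by simp
  have in1_obj: "Cod C in1 \<in> Obj C" and k1_obj: "Dom C k1 \<in> Obj C" and k2_obj: "Dom C k2 \<in> Obj C"
    by simp_all
  obtain i1 j1 r1 l1 where c1: "is_coproduct C i1 j1" and [simp]: "Dom C i1 = X" "Dom C j1 = Dom C k1"
      "r1 \<in> Arr C" "Dom C r1 = Cod C i1" "Cod C r1 = X" and r1: "r1 \<cdot> i1 = Ident C X" "is_zero C (r1 \<cdot> j1)"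
      and l1: "is_kernel C r1 l1" and flat1: "is_flat C X (Dom C k1) i1 j1 l1"
    by (rule flat_exists[OF _ k1_obj, of X]; (assumption | simp))
  obtain i2 j2 r2 l2 where c2: "is_coproduct C i2 j2" and [simp]: "Dom C i2 = X" "Dom C j2 = Dom C k2"
      "r2 \<in> Arr C" "Dom C r2 = Cod C i2" "Cod C r2 = X" and r2: "r2 \<cdot> i2 = Ident C X" "is_zero C (r2 \<cdot> j2)"
      and l2: "is_kernel C r2 l2" and flat2: "is_flat C X (Dom C k2) i2 j2 l2"
    by (rule flat_exists[OF _ k2_obj, of X]; (assumption | simp))
  obtain i j r l where c: "is_coproduct C i j" and [simp]: "Dom C i = X" "Dom C j = Cod C in1"
      "r \<in> Arr C" "Dom C r = Cod C i" "Cod C r = X" and r: "r \<cdot> i = Ident C X" "is_zero C (r \<cdot> j)"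
      and l: "is_kernel C r l" and flat: "is_flat C X (Cod C in1) i j l"
    by (rule flat_exists[OF _ in1_obj, of X]; (assumption | simp))
  note [simp] = is_coproductD[OF c1] is_coproductD[OF c2] is_coproductD[OF c]
    is_kernelD(2,3)[OF l1] is_kernelD(2,3)[OF l2] is_kernelD(2,3)[OF l]
  obtain \<phi>1 \<xi>1 \<eta>1 where \<phi>1: "is_regular_epi C \<phi>1" and [simp]: "Dom C \<phi>1 = Cod C i1" "Cod C \<phi>1 = Dom C d1"
      and \<phi>1ij: "\<phi>1 \<cdot> i1 = s1" "\<phi>1 \<cdot> j1 = k1"
      and [simp]: "\<xi>1 \<in> Arr C" "Dom C \<xi>1 = Dom C l1" "Cod C \<xi>1 = Dom C k1" and \<xi>1: "k1 \<cdot> \<xi>1 = \<phi>1 \<cdot> l1"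
      and [simp]: "\<eta>1 \<in> Arr C" "Dom C \<eta>1 = Dom C k1" "Cod C \<eta>1 = Dom C l1"
      and \<eta>1: "\<xi>1 \<cdot> \<eta>1 = Ident C (Dom C k1)"
    by (rule point_action_split_epi[OF pt1 k1 c1 _ _ _ _ _ _ _ l1]; (assumption | simp add: r1))
  obtain \<phi>2 \<xi>2 \<eta>2 where \<phi>2: "is_regular_epi C \<phi>2" and [simp]: "Dom C \<phi>2 = Cod C i2" "Cod C \<phi>2 = Dom C d2"
      and \<phi>2ij: "\<phi>2 \<cdot> i2 = s2" "\<phi>2 \<cdot> j2 = k2"
      and [simp]: "\<xi>2 \<in> Arr C" "Dom C \<xi>2 = Dom C l2" "Cod C \<xi>2 = Dom C k2" and \<xi>2: "k2 \<cdot> \<xi>2 = \<phi>2 \<cdot> l2"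
      and [simp]: "\<eta>2 \<in> Arr C" "Dom C \<eta>2 = Dom C k2" "Cod C \<eta>2 = Dom C l2"
      and \<eta>2: "\<xi>2 \<cdot> \<eta>2 = Ident C (Dom C k2)"
    by (rule point_action_split_epi[OF pt2 k2 c2 _ _ _ _ _ _ _ l2]; (assumption | simp add: r2))
  note [simp] = is_regular_epi_arr[OF \<phi>1] is_regular_epi_arr[OF \<phi>2]
  obtain \<sigma>1 u1 where [simp]: "\<sigma>1 \<in> Arr C" "Dom C \<sigma>1 = Cod C i1" "Cod C \<sigma>1 = Cod C i"
      and \<sigma>1: "\<sigma>1 \<cdot> i1 = i" "\<sigma>1 \<cdot> j1 = j \<cdot> in1"
      and [simp]: "u1 \<in> Arr C" "Dom C u1 = Dom C l1" "Cod C u1 = Dom C l" and u1: "l \<cdot> u1 = \<sigma>1 \<cdot> l1"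
      and map1: "is_flat_map C i1 j1 l1 i j l in1 u1"
    by (rule flat_map_exists[OF c1 _ _ _ r1 l1 c _ _ _ r l, of in1]; (assumption | simp))
  obtain \<sigma>2 u2 where [simp]: "\<sigma>2 \<in> Arr C" "Dom C \<sigma>2 = Cod C i2" "Cod C \<sigma>2 = Cod C i"
      and \<sigma>2: "\<sigma>2 \<cdot> i2 = i" "\<sigma>2 \<cdot> j2 = j \<cdot> in2"
      and [simp]: "u2 \<in> Arr C" "Dom C u2 = Dom C l2" "Cod C u2 = Dom C l" and u2: "l \<cdot> u2 = \<sigma>2 \<cdot> l2"
      and map2: "is_flat_map C i2 j2 l2 i j l in2 u2"
    by (rule flat_map_exists[OF c2 _ _ _ r2 l2 c _ _ _ r l, of in2]; (assumption | simp))

  obtain \<phi> where [simp]: "\<phi> \<in> Arr C" "Dom C \<phi> = Cod C i" "Cod C \<phi> = Cod C s"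
      and \<phi>ij: "\<phi> \<cdot> i = s" "\<phi> \<cdot> j = \<kappa> \<cdot> \<psi>"
    by (rule is_coproduct_factor[OF c, of s "\<kappa> \<cdot> \<psi>"]; (assumption | simp))
  \<comment> \<open>Here \<open>\<sigma>1\<close> and \<open>\<sigma>2\<close> extend
    \<open>in1\<close> and \<open>in2\<close> by the identity of \<open>X\<close>. The two equations
    say that \<open>\<phi>\<close> restricts on each summand to the canonical cover of the
    corresponding point, followed by \<open>a\<close> or \<open>b\<close>.\<close>
  have \<phi>\<sigma>1: "\<phi> \<cdot> \<sigma>1 = a \<cdot> \<phi>1"
    by (rule is_coproduct_jointly_epi[OF c1])
      (simp_all add: \<sigma>1 \<phi>1ij \<phi>ij as \<psi>1 Comp_eq_extend[OF \<phi>ij(2)])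
  have \<phi>\<sigma>2: "\<phi> \<cdot> \<sigma>2 = b \<cdot> \<phi>2"
    by (rule is_coproduct_jointly_epi[OF c2])
      (simp_all add: \<sigma>2 \<phi>2ij \<phi>ij bs \<psi>2 Comp_eq_extend[OF \<phi>ij(2)])
  have d\<phi>: "d \<cdot> \<phi> = r"
  proof (rule is_coproduct_jointly_epi[OF c])
    have "is_zero C ((d \<cdot> \<kappa>) \<cdot> \<psi>)"
      by (rule is_zero_Comp_right[OF is_kernelD(4)[OF \<kappa>]]) auto
    then show "(d \<cdot> \<phi>) \<cdot> j = r \<cdot> j"
      using r(2) \<phi>ij(2) by (intro is_zero_unique) auto
  qed (use r \<phi>ij in auto)
  \<comment> \<open>A monomorphism through which \<open>\<phi>\<close> factors also admits
    \<open>a \<cdot> \<phi>1\<close> and \<open>b \<cdot> \<phi>2\<close>. Fill-ins against the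
    covers \<open>\<phi>1\<close> and \<open>\<phi>2\<close> turn these into factorisations of
    \<open>a\<close> and \<open>b\<close>, to which \<open>extremal\<close> applies.\<close>
  have "is_regular_epi C \<phi>"
  proof (rule extremal_epi_is_regular_epi[OF regular])
    fix i' q
    assume i': "is_mono C i'" and [simp]: "q \<in> Arr C" "Dom C q = Dom C \<phi>" "Cod C q = Dom C i'"
      "Cod C i' = Cod C \<phi>" and q: "i' \<cdot> q = \<phi>"
    note [simp] = is_mono_arr[OF i']
    have eq1: "i' \<cdot> (q \<cdot> \<sigma>1) = a \<cdot> \<phi>1" and eq2: "i' \<cdot> (q \<cdot> \<sigma>2) = b \<cdot> \<phi>2"
      by (simp_all add: Comp_eq_extend[OF q] \<phi>\<sigma>1 \<phi>\<sigma>2)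
    obtain x where x: "x \<in> Arr C" "Dom C x = Cod C \<phi>1" "Cod C x = Dom C i'" "i' \<cdot> x = a"
        "x \<cdot> \<phi>1 = q \<cdot> \<sigma>1"
      by (rule is_regular_epi_lift[OF \<phi>1 i', of "q \<cdot> \<sigma>1" a]; (assumption | simp add: eq1))
    obtain y where y: "y \<in> Arr C" "Dom C y = Cod C \<phi>2" "Cod C y = Dom C i'" "i' \<cdot> y = b"
        "y \<cdot> \<phi>2 = q \<cdot> \<sigma>2"
      by (rule is_regular_epi_lift[OF \<phi>2 i', of "q \<cdot> \<sigma>2" b]; (assumption | simp add: eq2))
    show "is_iso C i'"
      by (rule extremal[OF i', of x y]) (use x y in simp_all)
  qed auto
  have zero: "is_zero C (d \<cdot> (\<phi> \<cdot> l))"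
    using is_kernelD(4)[OF l] by (simp add: Comp_eq_extend[OF d\<phi>])
  obtain \<phi>' where [simp]: "\<phi>' \<in> Arr C" "Dom C \<phi>' = Dom C (\<phi> \<cdot> l)" "Cod C \<phi>' = Dom C \<kappa>"
      and \<phi>': "\<kappa> \<cdot> \<phi>' = \<phi> \<cdot> l"
    by (rule is_kernel_factor[OF \<kappa>, of "\<phi> \<cdot> l"]; (assumption | simp add: zero))
  have "is_pullback C \<kappa> \<phi> \<phi>' l"
    by (rule kernel_restriction_is_pullback[OF \<kappa>]) (use l d\<phi> \<phi>' in auto)
  then have "is_regular_epi C \<phi>'"
    using is_regular_pullback_stable[OF regular] \<open>is_regular_epi C \<phi>\<close> by blast

  obtain A B where AB: "is_coproduct C A B" and [simp]: "Dom C A = Dom C l1" "Dom C B = Dom C l2"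
    using binary_coproducts unfolding has_binary_coproducts_def
    by (meson Dom_in_Obj is_kernelD(2)[OF l1] is_kernelD(2)[OF l2])
  note [simp] = is_coproductD[OF AB]
  obtain w where [simp]: "w \<in> Arr C" "Dom C w = Cod C A" "Cod C w = Cod C u1"
      and w: "w \<cdot> A = u1" "w \<cdot> B = u2"
    by (rule is_coproduct_factor[OF AB, of u1 u2]; (assumption | simp))
  have "w \<in> Hom C (Cod C A) (Dom C l)"
    by simp
  then have "is_regular_epi C w"
    using algebraically_coherent[unfolded is_algebraically_coherent_def, rule_format,
        OF \<open>X \<in> Obj C\<close> k1_obj k2_obj, of in1 in2 i1 j1 l1 i2 j2 l2 i j l u1 u2 A B w]
      in12 flat1 flat2 flat map1 map2 AB w by simp
  then have comp: "is_regular_epi C (\<phi>' \<cdot> w)"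
    using is_regular_epi_Comp[OF regular] \<open>is_regular_epi C \<phi>'\<close> by simp
  \<comment> \<open>This is the coproduct of the two actions. The equation
    \<open>\<psi> \<cdot> \<theta> = \<phi>' \<cdot> w\<close> can be tested after the monomorphism
    \<open>\<kappa>\<close> and on each summand separately.\<close>
  obtain \<theta> where [simp]: "\<theta> \<in> Arr C" "Dom C \<theta> = Cod C A" "Cod C \<theta> = Cod C (in1 \<cdot> \<xi>1)"
      and \<theta>: "\<theta> \<cdot> A = in1 \<cdot> \<xi>1" "\<theta> \<cdot> B = in2 \<cdot> \<xi>2"
    by (rule is_coproduct_factor[OF AB, of "in1 \<cdot> \<xi>1" "in2 \<cdot> \<xi>2"]; (assumption | simp))
  have "\<kappa> \<cdot> (\<psi> \<cdot> \<theta>) = \<kappa> \<cdot> (\<phi>' \<cdot> w)"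
  proof (rule is_coproduct_jointly_epi[OF AB])
    have "\<kappa> \<cdot> (\<psi> \<cdot> (in1 \<cdot> \<xi>1)) = a \<cdot> (\<phi>1 \<cdot> l1)"
      using Comp_eq_extend[OF \<psi>1, of \<xi>1] \<xi>1 by simp
    also have "\<dots> = \<phi> \<cdot> (l \<cdot> u1)"
      using Comp_eq_extend[OF \<phi>\<sigma>1, of l1] by (simp add: u1)
    also have "\<dots> = \<kappa> \<cdot> (\<phi>' \<cdot> u1)"
      by (simp add: Comp_eq_extend[OF \<phi>'])
    finally show "(\<kappa> \<cdot> (\<psi> \<cdot> \<theta>)) \<cdot> A = (\<kappa> \<cdot> (\<phi>' \<cdot> w)) \<cdot> A"
      by (simp add: \<theta> w)
    have "\<kappa> \<cdot> (\<psi> \<cdot> (in2 \<cdot> \<xi>2)) = b \<cdot> (\<phi>2 \<cdot> l2)"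
      using Comp_eq_extend[OF \<psi>2, of \<xi>2] \<xi>2 by simp
    also have "\<dots> = \<phi> \<cdot> (l \<cdot> u2)"
      using Comp_eq_extend[OF \<phi>\<sigma>2, of l2] by (simp add: u2)
    also have "\<dots> = \<kappa> \<cdot> (\<phi>' \<cdot> u2)"
      by (simp add: Comp_eq_extend[OF \<phi>'])
    finally show "(\<kappa> \<cdot> (\<psi> \<cdot> \<theta>)) \<cdot> B = (\<kappa> \<cdot> (\<phi>' \<cdot> w)) \<cdot> B"
      by (simp add: \<theta> w)
  qed auto
  then have "\<psi> \<cdot> \<theta> = \<phi>' \<cdot> w"
    by (rule is_mono_cancel[OF is_kernel_is_mono[OF \<kappa>]]) auto
  with comp have \<psi>\<theta>: "is_regular_epi C (\<psi> \<cdot> \<theta>)"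
    by simp
  \<comment> \<open>The units give \<open>\<theta> \<cdot> (A \<cdot> \<eta>1) = in1\<close> and
    \<open>\<theta> \<cdot> (B \<cdot> \<eta>2) = in2\<close>, so arrows that agree after
    \<open>\<theta>\<close> agree on both injections.\<close>
  show ?thesis
  proof (rule is_regular_epi_left_factor[OF \<psi>\<theta>])
    fix x y
    assume [simp]: "x \<in> Arr C" "y \<in> Arr C" "Dom C x = Cod C \<theta>" "Dom C y = Cod C \<theta>"
      "Cod C x = Cod C y" and eq: "x \<cdot> \<theta> = y \<cdot> \<theta>"
    have "x \<cdot> (\<theta> \<cdot> (A \<cdot> \<eta>1)) = y \<cdot> (\<theta> \<cdot> (A \<cdot> \<eta>1))" "x \<cdot> (\<theta> \<cdot> (B \<cdot> \<eta>2)) = y \<cdot> (\<theta> \<cdot> (B \<cdot> \<eta>2))"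
      by (simp_all add: Comp_eq_extend[OF eq])
    then have xy: "x \<cdot> in1 = y \<cdot> in1" "x \<cdot> in2 = y \<cdot> in2"
      using \<eta>1 \<eta>2 by (simp_all add: Comp_eq_extend[OF \<theta>(1)] Comp_eq_extend[OF \<theta>(2)])
    show "x = y"
      by (rule is_coproduct_jointly_epi[OF in12]) (simp_all add: xy)
  qed auto
qed

end


section \<open>Normal subobjects, images and normalisations\<close>

context category
begin

lemma is_productD:
  assumes "is_product C p q"
  shows "p \<in> Arr C" "q \<in> Arr C" "Dom C q = Dom C p"
  using assms unfolding is_product_def by auto

lemma is_product_jointly_mono:
  assumes pq: "is_product C p q"
    and xy: "x \<in> Arr C" "y \<in> Arr C" "Cod C x = Dom C p" "Cod C y = Dom C p" "Dom C x = Dom C y"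
    and eq: "p \<cdot> x = p \<cdot> y" "q \<cdot> x = q \<cdot> y"
  shows "x = y"
proof -
  note [simp] = is_productD[OF pq] xy
  have "p \<cdot> x \<in> Hom C (Dom C y) (Cod C p)" "q \<cdot> x \<in> Hom C (Dom C y) (Cod C q)"
    by auto
  then have "\<exists>!u. u \<in> Hom C (Dom C y) (Dom C p) \<and> p \<cdot> u = p \<cdot> x \<and> q \<cdot> u = q \<cdot> x"
    using pq unfolding is_product_def by blast
  then show ?thesis
    using eq by (metis Hom_iff xy)
qed

lemma is_intersection_is_mono:
  assumes "is_intersection C a b w"
  shows "is_mono C w"
proof -
  obtain p q where a: "is_mono C a" and b: "is_mono C b" and pb: "is_pullback C a b p q"
      and w: "w = a \<cdot> p"
    using assms unfolding is_intersection_def by blast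
  note [simp] = is_pullbackD(1-4,6-8)[OF pb]
  have eq: "a \<cdot> p = b \<cdot> q"
    by (rule is_pullbackD(9)[OF pb])
  show ?thesis
    unfolding is_mono_def
  proof (intro conjI allI ballI impI)
    fix T x y
    assume "x \<in> Hom C T (Dom C w)" "y \<in> Hom C T (Dom C w)" and wxy: "w \<cdot> x = w \<cdot> y"
    then have [simp]: "x \<in> Arr C" "y \<in> Arr C" "Dom C x = T" "Dom C y = T" "Cod C x = Dom C p"
        "Cod C y = Dom C p"
      unfolding w by auto
    have axy: "a \<cdot> (p \<cdot> x) = a \<cdot> (p \<cdot> y)"
      using wxy unfolding w by simp
    then have bxy: "b \<cdot> (q \<cdot> x) = b \<cdot> (q \<cdot> y)"
      using Comp_eq_extend[OF eq, of x] Comp_eq_extend[OF eq, of y] by simp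
    have "p \<cdot> x = p \<cdot> y"
      by (rule is_mono_cancel[OF a axy]) auto
    moreover have "q \<cdot> x = q \<cdot> y"
      by (rule is_mono_cancel[OF b bxy]) auto
    ultimately show "x = y"
      by (rule is_pullback_jointly_mono[OF pb, rotated 5]) auto
  qed (simp add: w)
qed

text \<open>Neither the cover \<open>e\<close> nor the monomorphism \<open>w\<close> changes the
  image. One fill-in against \<open>w\<close> moves \<open>c\<close> into the domain of
  \<open>w\<close>, a second one against \<open>c'\<close> extends \<open>e'\<close> along
  \<open>e\<close>; the cover \<open>d\<close> of the image is then the left factor of the regular
  epimorphism \<open>e'\<close>.\<close>

lemma is_image_regular_epi_Comp:
  assumes e: "is_regular_epi C e" and w: "is_mono C w"
    and [simp]: "h \<in> Arr C" "Dom C h = Cod C e" "Cod C h = Dom C w"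
    and c: "is_image C (w \<cdot> (h \<cdot> e)) c" and [simp]: "Cod C c = Cod C w"
  shows "\<exists>c'\<in>Hom C (Dom C c) (Dom C w). w \<cdot> c' = c \<and> is_image C h c'"
proof -
  note [simp] = is_regular_epi_arr[OF e] is_mono_arr[OF w]
  have mono_c: "is_mono C c"
    using c unfolding is_image_def by blast
  obtain e' where e': "is_regular_epi C e'" and [simp]: "Dom C e' = Dom C e" "Cod C e' = Dom C c"
      and ce': "c \<cdot> e' = w \<cdot> (h \<cdot> e)"
    using c unfolding is_image_def by auto
  note [simp] = is_mono_arr[OF mono_c] is_regular_epi_arr[OF e']
  obtain c' where [simp]: "c' \<in> Arr C" "Dom C c' = Cod C e'" "Cod C c' = Dom C w"
      and c': "w \<cdot> c' = c" "c' \<cdot> e' = h \<cdot> e"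
    by (rule is_regular_epi_lift[OF e' w, of "h \<cdot> e" c]; (assumption | simp add: ce'))
  have mono_c': "is_mono C c'"
    by (rule is_mono_right_factor[of w]) (use mono_c c' in simp_all)
  obtain d where [simp]: "d \<in> Arr C" "Dom C d = Cod C e" "Cod C d = Dom C c'"
      and d: "c' \<cdot> d = h" "d \<cdot> e = e'"
    by (rule is_regular_epi_lift[OF e mono_c', of e' h]; (assumption | simp add: c'))
  have "is_regular_epi C d"
  proof (rule is_regular_epi_left_factor[of d e])
    fix x y
    assume "x \<in> Arr C" "y \<in> Arr C" "Dom C x = Cod C e" "Dom C y = Cod C e" "Cod C x = Cod C y"
      "x \<cdot> e = y \<cdot> e"
    then show "x = y"
      by (metis is_regular_epi_cancel[OF e])
  qed (use d e' in simp_all)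
  then have "is_image C h c'"
    unfolding is_image_def using mono_c' d(1) by (intro conjI bexI[of _ d]) simp_all
  then show ?thesis
    using c'(1) by (intro bexI[of _ c']) simp_all
qed

text \<open>A cokernel of \<open>f\<close> is a coequaliser of \<open>f\<close> and the parallel
  zero arrow.\<close>

lemma is_cokernel_is_regular_epi:
  assumes pointed: "is_pointed C" and q: "is_cokernel C f q"
  shows "is_regular_epi C q"
proof -
  have [simp]: "f \<in> Arr C" "q \<in> Arr C" "Dom C q = Cod C f" and qf: "is_zero C (q \<cdot> f)"
    using q unfolding is_cokernel_def by auto
  obtain z where z: "is_zero C z" and [simp]: "z \<in> Arr C" "Dom C z = Dom C f" "Cod C z = Cod C f"
    by (rule is_zero_exists[OF pointed, of "Dom C f" "Cod C f"]; (assumption | simp))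
  have tz: "is_zero C (t \<cdot> z)" if "t \<in> Arr C" "Dom C t = Cod C f" for t
    by (rule is_zero_Comp_left[OF z]) (use that in simp_all)
  have "is_coequalizer C f z q"
    unfolding is_coequalizer_def
  proof (intro conjI allI ballI impI)
    show "q \<cdot> f = q \<cdot> z"
      by (rule is_zero_unique[OF qf tz]) simp_all
    fix T t
    assume t: "t \<in> Hom C (Cod C f) T" and "t \<cdot> f = t \<cdot> z"
    then have "is_zero C (t \<cdot> f)"
      using tz[of t] by simp
    then show "\<exists>!u. u \<in> Hom C (Cod C q) T \<and> u \<cdot> q = t"
      using q t unfolding is_cokernel_def by blast
  qed simp_all
  then show ?thesis
    unfolding is_regular_epi_def by blast
qed

lemma is_internal_groupoidD:
  assumes "is_internal_groupoid C G"
  shows "Src G \<in> Arr C" "Tgt G \<in> Arr C" "Idn G \<in> Arr C"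
    "Dom C (Tgt G) = Dom C (Src G)" "Cod C (Tgt G) = Cod C (Src G)"
    "Dom C (Idn G) = Cod C (Src G)" "Cod C (Idn G) = Dom C (Src G)"
    "Src G \<cdot> Idn G = Ident C (Cod C (Src G))" "Tgt G \<cdot> Idn G = Ident C (Cod C (Src G))"
  using assms unfolding is_internal_groupoid_def arrows_object_def objects_object_def by auto

lemma is_internal_functorD:
  assumes "is_internal_functor C G H f f0"
  shows "f \<in> Arr C" "Dom C f = Dom C (Src G)" "Cod C f = Dom C (Src H)"
    "f0 \<in> Arr C" "Dom C f0 = Cod C (Src G)" "Cod C f0 = Cod C (Src H)"
    "Src H \<cdot> f = f0 \<cdot> Src G" "Tgt H \<cdot> f = f0 \<cdot> Tgt G" "Idn H \<cdot> f0 = f \<cdot> Idn G"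
  using assms unfolding is_internal_functor_def arrows_object_def objects_object_def by auto

lemma is_normalisationD:
  assumes "is_normalisation C D t"
  shows "is_mono C t" "Cod C t = Dom C (Src (GU D))"
    "is_zero C (Src (GU D) \<cdot> t)" "is_zero C (Src (GL D) \<cdot> t)"
proof -
  obtain kU kL where kU: "is_kernel C (Src (GU D)) kU" and kL: "is_kernel C (Src (GL D)) kL"
      and i: "is_intersection C kU kL t"
    using assms unfolding is_normalisation_def by blast
  obtain p q where pb: "is_pullback C kU kL p q" and t: "t = kU \<cdot> p"
    using i unfolding is_intersection_def by blast
  note [simp] = is_kernelD(1-3)[OF kU] is_kernelD(1-3)[OF kL] is_pullbackD(3,4,6-8)[OF pb]
  show "is_mono C t"
    using i by (rule is_intersection_is_mono)
  show "Cod C t = Dom C (Src (GU D))"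
    unfolding t by simp
  have "is_zero C ((Src (GU D) \<cdot> kU) \<cdot> p)"
    by (rule is_zero_Comp_right[OF is_kernelD(4)[OF kU]]) simp_all
  then show "is_zero C (Src (GU D) \<cdot> t)"
    by (simp add: t)
  have "is_zero C ((Src (GL D) \<cdot> kL) \<cdot> q)"
    by (rule is_zero_Comp_right[OF is_kernelD(4)[OF kL]]) simp_all
  then show "is_zero C (Src (GL D) \<cdot> t)"
    by (simp add: t is_pullbackD(9)[OF pb])
qed

text \<open>The lifts of \<open>x\<close> through the two kernels agree in the corner, so they
  combine through the pullback that defines the intersection.\<close>

lemma is_normalisation_factor:
  assumes "is_normalisation C D t" and [simp]: "x \<in> Arr C" "Cod C x = Dom C (Src (GU D))"
    and xU: "is_zero C (Src (GU D) \<cdot> x)" and xL: "is_zero C (Src (GL D) \<cdot> x)"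
  obtains u where "u \<in> Arr C" "Dom C u = Dom C x" "Cod C u = Dom C t" "t \<cdot> u = x"
proof -
  obtain kU kL where kU: "is_kernel C (Src (GU D)) kU" and kL: "is_kernel C (Src (GL D)) kL"
      and i: "is_intersection C kU kL t"
    using assms unfolding is_normalisation_def by blast
  obtain p q where pb: "is_pullback C kU kL p q" and t: "t = kU \<cdot> p"
    using i unfolding is_intersection_def by blast
  note [simp] = is_kernelD(1-3)[OF kU] is_kernelD(1,2)[OF kL] is_pullbackD(3,4,6-8)[OF pb]
  have [simp]: "Dom C (Src (GL D)) = Dom C (Src (GU D))"
    using is_pullbackD(5)[OF pb] is_kernelD(3)[OF kU] is_kernelD(3)[OF kL] by simp
  obtain y where y: "y \<in> Arr C" "Dom C y = Dom C x" "Cod C y = Dom C kU" "kU \<cdot> y = x"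
    by (rule is_kernel_factor[OF kU, of x]; (assumption | simp add: xU))
  obtain y' where y': "y' \<in> Arr C" "Dom C y' = Dom C x" "Cod C y' = Dom C kL" "kL \<cdot> y' = x"
    by (rule is_kernel_factor[OF kL, of x]; (assumption | simp add: xL))
  obtain u where u: "u \<in> Arr C" "Dom C u = Dom C y" "Cod C u = Dom C p" "p \<cdot> u = y" "q \<cdot> u = y'"
    by (rule is_pullback_factor[OF pb, of y y']; (assumption | (use y y' in simp)))
  show thesis
    by (rule that[of u]) (use u y in \<open>simp_all add: t\<close>)
qed

end

context semi_abelian_category
begin

text \<open>An element of the kernel pair with zero source is a pair \<open>(0, y)\<close> with
  \<open>y\<close> killed by \<open>q\<close>, that is, with \<open>y\<close> in \<open>m\<close>.
  The kernel is therefore the pair \<open>(0, m)\<close>, chosen with the same domain as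
  \<open>m\<close>.\<close>

lemma normal_groupoid_kernel:
  assumes R: "is_normal_groupoid C m R"
  obtains k where "is_kernel C (Src R) k" "Dom C k = Dom C m" "Tgt R \<cdot> k = m"
proof -
  obtain q f where q: "is_cokernel C m q" and kp: "is_pullback C q q (Src R) (Tgt R)"
      and f: "is_kernel C f m"
    using R unfolding is_normal_groupoid_def is_kernel_pair_def is_normal_mono_def by blast
  have [simp]: "m \<in> Arr C" "q \<in> Arr C" "Dom C q = Cod C m" and qm: "is_zero C (q \<cdot> m)"
    using q unfolding is_cokernel_def by auto
  note [simp] = is_pullbackD(3,4,6-8)[OF kp, simplified] is_kernelD(1,2)[OF f]
  have [simp]: "Dom C f = Cod C m"
    using is_kernelD(3)[OF f] by simp
  have "f \<in> Hom C (Cod C m) (Cod C f)"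
    by simp
  \<comment> \<open>The subobject \<open>m\<close> is a kernel of some \<open>f\<close>, whereas the
    groupoid comes from its cokernel \<open>q\<close>. Since \<open>f\<close> factors through
    \<open>q\<close>, it takes equal values on source and target; an arrow with zero source
    therefore has its target in \<open>m\<close>.\<close>
  then obtain f' where f': "f' \<in> Hom C (Cod C q) (Cod C f)" "f' \<cdot> q = f"
    using q is_kernelD(4)[OF f] unfolding is_cokernel_def by blast
  have [simp]: "f' \<in> Arr C" "Dom C f' = Cod C q"
    using f' by auto
  obtain z where z: "is_zero C z" and [simp]: "z \<in> Arr C" "Dom C z = Dom C m" "Cod C z = Cod C m"
    by (rule is_zero_exists[OF pointed, of "Dom C m" "Cod C m"]; (assumption | simp))
  have qz: "q \<cdot> z = q \<cdot> m"
    by (rule is_zero_unique[OF is_zero_Comp_left[OF z] qm]) simp_all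
  obtain k where [simp]: "k \<in> Arr C" "Dom C k = Dom C z" "Cod C k = Dom C (Src R)"
      and k: "Src R \<cdot> k = z" "Tgt R \<cdot> k = m"
    by (rule is_pullback_factor[OF kp, of z m]; (assumption | simp add: qz))
  have "is_kernel C (Src R) k"
    unfolding is_kernel_def
  proof (intro conjI allI ballI impI)
    fix T x
    assume "x \<in> Hom C T (Dom C (Src R))" and zero: "is_zero C (Src R \<cdot> x)"
    then have [simp]: "x \<in> Arr C" "Dom C x = T" "Cod C x = Dom C (Src R)"
      by auto
    have "f \<cdot> (Tgt R \<cdot> x) = f' \<cdot> (q \<cdot> (Src R \<cdot> x))"
      using Comp_eq_extend[OF f'(2), of "Tgt R \<cdot> x"] Comp_eq_extend[OF is_pullbackD(9)[OF kp], of x]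
      by simp
    then have zero': "is_zero C (f \<cdot> (Tgt R \<cdot> x))"
      by (simp add: is_zero_Comp_left zero)
    obtain u where [simp]: "u \<in> Arr C" "Dom C u = Dom C (Tgt R \<cdot> x)" "Cod C u = Dom C m"
        and u: "m \<cdot> u = Tgt R \<cdot> x"
      by (rule is_kernel_factor[OF f, of "Tgt R \<cdot> x"]; (assumption | simp add: zero'))
    have "Src R \<cdot> (k \<cdot> u) = Src R \<cdot> x"
      by (rule is_zero_unique) (simp_all add: zero Comp_eq_extend[OF k(1)] is_zero_Comp_right z)
    then have "k \<cdot> u = x"
      by (rule is_pullback_jointly_mono[OF kp, rotated 5])
        (simp_all add: Comp_eq_extend[OF k(2)] u)
    moreover have "v = u" if "v \<in> Hom C T (Dom C k)" "k \<cdot> v = x" for v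
    proof (rule is_mono_cancel[OF is_kernel_is_mono[OF f]])
      show "m \<cdot> v = m \<cdot> u"
        using that Comp_eq_extend[OF k(2), of v] by (simp add: u)
    qed (use that in simp_all)
    moreover have "u \<in> Hom C T (Dom C k)"
      by simp
    ultimately show "\<exists>!u. u \<in> Hom C T (Dom C k) \<and> k \<cdot> u = x"
      by blast
  qed (simp_all add: k z)
  then show thesis
    using k(2) by (intro that[of k]) simp_all
qed

text \<open>If both degeneracies factor through \<open>i\<close>, the pushout property combines the
  factors into a factorisation of \<open>q\<close> through \<open>i\<close>. As \<open>q\<close> is
  a regular epimorphism, a fill-in against \<open>i\<close> gives a section of
  \<open>i\<close>.\<close>

lemma tensor_degeneracies_extremal:
  assumes D: "is_tensor_double_groupoid C R S D" and i: "is_mono C i"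
    and [simp]: "Cod C i = Cod C (Idn (GU D))"
    and [simp]: "x \<in> Arr C" "Cod C x = Dom C i" and x: "i \<cdot> x = Idn (GU D)"
    and [simp]: "y \<in> Arr C" "Cod C y = Dom C i" and y: "i \<cdot> y = Idn (GL D)"
  shows "is_iso C i"
proof -
  obtain eU eL dU j q where po: "is_pushout C (Idn R) (Idn S) eU eL" and q: "is_cokernel C j q"
      and dU: "dU \<in> Hom C (Cod C eU) (arrows_object C R)"
        "Src (GU D) \<in> Hom C (Cod C q) (arrows_object C R)" "Src (GU D) \<cdot> q = dU"
      and U: "Idn (GU D) = q \<cdot> eU" and L: "Idn (GL D) = q \<cdot> eL"
    using D unfolding is_tensor_double_groupoid_def by blast
  have [simp]: "Idn R \<in> Arr C" "Idn S \<in> Arr C" "eU \<in> Arr C" "eL \<in> Arr C" "Dom C (Idn S) = Dom C (Idn R)"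
      "Dom C eU = Cod C (Idn R)" "Dom C eL = Cod C (Idn S)" "Cod C eL = Cod C eU"
      and eq: "eU \<cdot> Idn R = eL \<cdot> Idn S"
    using po unfolding is_pushout_def by auto
  note [simp] = is_mono_arr[OF i]
  have reg: "is_regular_epi C q"
    by (rule is_cokernel_is_regular_epi[OF pointed q])
  note [simp] = is_regular_epi_arr[OF reg]
  have [simp]: "Dom C q = Cod C eU"
    using dU by auto
  have [simp]: "Cod C (Idn (GU D)) = Cod C q"
    unfolding U by simp
  have [simp]: "Dom C x = Dom C eU" "Dom C y = Dom C eL"
    using arg_cong[OF x, of "Dom C"] arg_cong[OF y, of "Dom C"] by (simp_all add: U L)
  have "i \<cdot> (x \<cdot> Idn R) = i \<cdot> (y \<cdot> Idn S)"
    by (simp add: Comp_eq_extend[OF x] Comp_eq_extend[OF y] U L eq)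
  then have xy: "x \<cdot> Idn R = y \<cdot> Idn S"
    by (rule is_mono_cancel[OF i]) simp_all
  have "x \<in> Hom C (Cod C (Idn R)) (Dom C i)" "y \<in> Hom C (Cod C (Idn S)) (Dom C i)"
    by simp_all
  then obtain u where u: "u \<in> Hom C (Cod C eU) (Dom C i)" "u \<cdot> eU = x" "u \<cdot> eL = y"
    using po xy unfolding is_pushout_def by blast
  have [simp]: "u \<in> Arr C" "Dom C u = Cod C eU" "Cod C u = Dom C i"
    using u by auto
  have "q \<cdot> eU \<in> Hom C (Cod C (Idn R)) (Cod C q)" "q \<cdot> eL \<in> Hom C (Cod C (Idn S)) (Cod C q)"
    "(q \<cdot> eU) \<cdot> Idn R = (q \<cdot> eL) \<cdot> Idn S"
    using eq by simp_all
  then have "\<exists>!v. v \<in> Hom C (Cod C eU) (Cod C q) \<and> v \<cdot> eU = q \<cdot> eU \<and> v \<cdot> eL = q \<cdot> eL"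
    using po unfolding is_pushout_def by blast
  moreover have "i \<cdot> u \<in> Hom C (Cod C eU) (Cod C q)" "(i \<cdot> u) \<cdot> eU = q \<cdot> eU" "(i \<cdot> u) \<cdot> eL = q \<cdot> eL"
    using u x y by (simp_all add: U L)
  moreover have "q \<in> Hom C (Cod C eU) (Cod C q)"
    by simp
  ultimately have iu: "i \<cdot> u = q"
    by blast
  obtain v where "v \<in> Arr C" "Dom C v = Cod C q" "Cod C v = Dom C i" "i \<cdot> v = Ident C (Cod C q)"
      "v \<cdot> q = u"
    by (rule is_regular_epi_lift[OF reg i, of u "Ident C (Cod C q)"]; (assumption | simp add: iu))
  then show ?thesis
    by (intro split_epi_mono_is_iso[OF i, of v]) simp_all
qed

end

theorem mainTheorem6:
  fixes C :: "('o, 'a) cat" (structure)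
    and L :: 'o
    and m n w t h c :: 'a
    and R S :: "'a igpd"
    and D E :: "'a dgpd"
  assumes "algebraically_coherent_semi_abelian_category C"
    and "is_normal_mono C m" and "Cod C m = L"
    and "is_normal_mono C n" and "Cod C n = L"
    and "is_normal_groupoid C m R"
    and "is_normal_groupoid C n S"
    and "is_tensor_double_groupoid C R S D"
    and "is_normalisation C D t"
    and "is_double_equivalence_relation C R S E"
    and "is_intersection C m n w"
    and "is_canonical_map C D t E w h"
    and "is_Higgins_commutator C m n c"
  shows "\<exists>c'\<in>Hom C (Dom C c) (Dom C w). w \<cdot> c' = c \<and> is_image C h c'"
proof -
  interpret algebraically_coherent_semi_abelian_category C
    by fact
  have D: "is_double_groupoid C D" and [simp]: "GR D = R" "GS D = S"
    using assms(8) unfolding is_tensor_double_groupoid_def by auto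
  have [simp]: "GR E = R"
    using assms(10) unfolding is_double_equivalence_relation_def by auto
  have [simp]: "m \<in> Arr C" "n \<in> Arr C" "Cod C n = Cod C m"
    using assms(2-5) unfolding is_normal_mono_def is_kernel_def by auto
  have gpd: "is_internal_groupoid C R" "is_internal_groupoid C S" "is_internal_groupoid C (GU D)"
      "is_internal_groupoid C (GL D)" "is_internal_groupoid C (GU E)"
    using D assms(6,7,10)
    unfolding is_normal_groupoid_def is_double_groupoid_def is_double_equivalence_relation_def
    by auto
  have fR: "is_internal_functor C (GL D) R (Src (GU D)) (Src S)"
    and fS: "is_internal_functor C (GU D) S (Src (GL D)) (Src R)"
    and fU: "is_internal_functor C R (GL D) (Idn (GU D)) (Idn S)"
    and fL: "is_internal_functor C S (GU D) (Idn (GL D)) (Idn R)"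
    using D unfolding is_double_groupoid_def by auto
  note [simp] = is_internal_groupoidD[OF gpd(1)] is_internal_groupoidD[OF gpd(2)]
    is_internal_groupoidD[OF gpd(3)] is_internal_groupoidD[OF gpd(4)] is_internal_groupoidD[OF gpd(5)]
    is_internal_functorD(2,3,6)[OF fR] is_internal_functorD(3)[OF fS]
  have SU: "Src R \<cdot> Src (GU D) = Src S \<cdot> Src (GL D)"
    by (rule is_internal_functorD(7)[OF fR])
  have II: "Idn (GL D) \<cdot> Idn S = Idn (GU D) \<cdot> Idn R"
    by (rule is_internal_functorD(9)[OF fU])
  have SLIU: "Src (GL D) \<cdot> Idn (GU D) = Idn S \<cdot> Src R"
    by (rule is_internal_functorD(7)[OF fU])
  have SUIL: "Src (GU D) \<cdot> Idn (GL D) = Idn R \<cdot> Src S"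
    by (rule is_internal_functorD(7)[OF fL])
  have TUIL: "Tgt (GU D) \<cdot> Idn (GL D) = Idn R \<cdot> Tgt S"
    by (rule is_internal_functorD(8)[OF fL])

  \<comment> \<open>Kernels of the edge groupoids and the data of the Higgins commutator\<close>
  obtain kM where kM: "is_kernel C (Src R) kM" and [simp]: "Dom C kM = Dom C m"
      and TkM: "Tgt R \<cdot> kM = m"
    using normal_groupoid_kernel[OF assms(6)] .
  obtain kN where kN: "is_kernel C (Src S) kN" and [simp]: "Dom C kN = Dom C n"
      and TkN: "Tgt S \<cdot> kN = n"
    using normal_groupoid_kernel[OF assms(7)] .
  note [simp] = is_kernelD(2,3)[OF kM] is_kernelD(2,3)[OF kN]
  have [simp]: "Cod C (Src R) = Cod C m"
    using arg_cong[OF TkM, of "Cod C"] by simp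

  obtain i j p q r k \<tau> where ij: "is_coproduct C i j" and dom_ij: "Dom C i = Dom C m" "Dom C j = Dom C n"
      and pq: "is_product C p q" and cod_pq: "Cod C p = Dom C m" "Cod C q = Dom C n"
      and r: "r \<in> Hom C (Cod C i) (Dom C p)"
      and pri: "p \<cdot> r \<cdot> i = Ident C (Dom C m)" and prj: "is_zero C (p \<cdot> r \<cdot> j)"
      and qri: "is_zero C (q \<cdot> r \<cdot> i)" and qrj: "q \<cdot> r \<cdot> j = Ident C (Dom C n)"
      and k: "is_kernel C r k"
      and \<tau>: "\<tau> \<in> Hom C (Cod C i) (Cod C m)" "\<tau> \<cdot> i = m" "\<tau> \<cdot> j = n"
      and c: "is_image C (\<tau> \<cdot> k) c"
    using assms(13) unfolding is_Higgins_commutator_def by blast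
  note [simp] = dom_ij cod_pq r[unfolded Hom_iff] \<tau>(1)[unfolded Hom_iff]
  note [simp] = is_coproductD[OF ij] is_productD[OF pq] is_kernelD(2,3)[OF k]

  \<comment> \<open>The arrow from \<open>M + N\<close> to the upper left corner\<close>
  obtain \<beta> where [simp]: "\<beta> \<in> Arr C" "Dom C \<beta> = Cod C i" "Cod C \<beta> = Cod C (Idn (GU D) \<cdot> kM)"
      and \<beta>: "\<beta> \<cdot> i = Idn (GU D) \<cdot> kM" "\<beta> \<cdot> j = Idn (GL D) \<cdot> kN"
    by (rule is_coproduct_factor[OF ij, of "Idn (GU D) \<cdot> kM" "Idn (GL D) \<cdot> kN"]; (assumption | simp))
  \<comment> \<open>The degenerate square on an element of \<open>M\<close> has this element as its
    domain edge in \<open>R\<close> and a zero domain edge in \<open>S\<close>; for \<open>N\<close>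
    the roles are exchanged. Hence the domain edges of \<open>\<beta>\<close> are the components of
    \<open>r\<close>, included by \<open>kM\<close> and \<open>kN\<close>.\<close>
  have SU\<beta>: "Src (GU D) \<cdot> \<beta> = kM \<cdot> (p \<cdot> r)"
  proof (rule is_coproduct_jointly_epi[OF ij])
    show "(Src (GU D) \<cdot> \<beta>) \<cdot> i = (kM \<cdot> (p \<cdot> r)) \<cdot> i"
      using pri by (simp add: \<beta> Comp_eq_extend[OF is_internal_groupoidD(8)[OF gpd(3)]])
    have "is_zero C (Src (GU D) \<cdot> (\<beta> \<cdot> j))"
      using is_zero_Comp_left[OF is_kernelD(4)[OF kN], of "Idn R"]
      by (simp add: \<beta> Comp_eq_extend[OF SUIL])
    then show "(Src (GU D) \<cdot> \<beta>) \<cdot> j = (kM \<cdot> (p \<cdot> r)) \<cdot> j"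
      using is_zero_Comp_left[OF prj, of kM] by (intro is_zero_unique) simp_all
  qed simp_all
  have SL\<beta>: "Src (GL D) \<cdot> \<beta> = kN \<cdot> (q \<cdot> r)"
  proof (rule is_coproduct_jointly_epi[OF ij])
    show "(Src (GL D) \<cdot> \<beta>) \<cdot> j = (kN \<cdot> (q \<cdot> r)) \<cdot> j"
      using qrj by (simp add: \<beta> Comp_eq_extend[OF is_internal_groupoidD(8)[OF gpd(4)]])
    have "is_zero C (Src (GL D) \<cdot> (\<beta> \<cdot> i))"
      using is_zero_Comp_left[OF is_kernelD(4)[OF kM], of "Idn S"]
      by (simp add: \<beta> Comp_eq_extend[OF SLIU])
    then show "(Src (GL D) \<cdot> \<beta>) \<cdot> i = (kN \<cdot> (q \<cdot> r)) \<cdot> i"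
      using is_zero_Comp_left[OF qri, of kN] by (intro is_zero_unique) simp_all
  qed simp_all
  \<comment> \<open>The last corner of the degenerate square on an element of \<open>M\<close> or
    \<open>N\<close> is the target of that element, so on the summands it is \<open>m\<close> and
    \<open>n\<close>.\<close>
  have corner\<beta>: "Tgt R \<cdot> (Tgt (GU D) \<cdot> \<beta>) = \<tau>"
    by (rule is_coproduct_jointly_epi[OF ij])
      (simp_all add: \<beta> \<tau> TkM TkN Comp_eq_extend[OF TUIL]
        Comp_eq_extend[OF is_internal_groupoidD(9)[OF gpd(1)]]
        Comp_eq_extend[OF is_internal_groupoidD(9)[OF gpd(3)]])

  \<comment> \<open>Covering the kernel of the corner over \<open>L\<close>\<close>
  define d where "d = Src R \<cdot> Src (GU D)"
  have [simp]: "d \<in> Arr C" "Dom C d = Dom C (Src (GU D))" "Cod C d = Cod C (Src R)"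
    by (simp_all add: d_def)
  \<comment> \<open>Here \<open>d\<close> is the first corner of a square and its section is the
    doubly degenerate square; both degeneracies are then morphisms of points over
    \<open>L\<close>.\<close>
  have pt: "is_point C d (Idn (GU D) \<cdot> Idn R)"
    by (simp add: is_point_def d_def Comp_eq_extend[OF is_internal_groupoidD(8)[OF gpd(3)]])
  obtain \<kappa> where \<kappa>: "is_kernel C d \<kappa>"
    using kernel_exists[of d] by auto
  note [simp] = is_kernelD(2,3)[OF \<kappa>]
  have "is_zero C ((Src R \<cdot> kM) \<cdot> (p \<cdot> r))"
    by (rule is_zero_Comp_right[OF is_kernelD(4)[OF kM]]) simp_all
  then have d\<beta>: "is_zero C (d \<cdot> \<beta>)"
    by (simp add: d_def SU\<beta>)
  obtain \<psi> where [simp]: "\<psi> \<in> Arr C" "Dom C \<psi> = Dom C \<beta>" "Cod C \<psi> = Dom C \<kappa>"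
      and \<psi>: "\<kappa> \<cdot> \<psi> = \<beta>"
    by (rule is_kernel_factor[OF \<kappa>, of \<beta>]; (assumption | simp add: d\<beta>))
  have "is_point C (Src R) (Idn R)" "is_point C (Src S) (Idn S)"
    by (simp_all add: is_point_def)
  then have "is_regular_epi C \<psi>"
  proof (rule point_kernels_regular_epi[OF _ kM _ kN pt \<kappa> _ _ _ _ _ _ _ _ _ _ _ ij])
    fix i' x y
    assume "is_mono C i'" "Cod C i' = Dom C d" "x \<in> Arr C" "Cod C x = Dom C i'"
      "i' \<cdot> x = Idn (GU D)" "y \<in> Arr C" "Cod C y = Dom C i'" "i' \<cdot> y = Idn (GL D)"
    then show "is_iso C i'"
      by (intro tensor_degeneracies_extremal[OF assms(8), of i' x y]) simp_all
  qed (simp_all add: II \<beta> Comp_eq_extend[OF \<psi>])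

  \<comment> \<open>Covering the tensor product by \<open>M \<diamond> N\<close>\<close>
  note t = is_normalisationD[OF assms(9)]
  note [simp] = is_mono_arr[OF t(1)] t(2)
  have "is_zero C (d \<cdot> t)"
    using is_zero_Comp_left[OF t(3), of "Src R"] by (simp add: d_def)
  obtain t' where [simp]: "t' \<in> Arr C" "Dom C t' = Dom C t" "Cod C t' = Dom C \<kappa>"
      and t': "\<kappa> \<cdot> t' = t"
    by (rule is_kernel_factor[OF \<kappa>, of t]; (assumption | simp add: \<open>is_zero C (d \<cdot> t)\<close>))
  have rk: "is_zero C (r \<cdot> k)"
    by (rule is_kernelD(4)[OF k])
  have U\<beta>k: "is_zero C (Src (GU D) \<cdot> (\<beta> \<cdot> k))"
    using is_zero_Comp_left[OF rk, of "kM \<cdot> p"] by (simp add: Comp_eq_extend[OF SU\<beta>])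
  have L\<beta>k: "is_zero C (Src (GL D) \<cdot> (\<beta> \<cdot> k))"
    using is_zero_Comp_left[OF rk, of "kN \<cdot> q"] by (simp add: Comp_eq_extend[OF SL\<beta>])
  \<comment> \<open>On \<open>M \<diamond> N\<close>, the domain of \<open>k\<close>, the arrow
    \<open>r\<close> vanishes, and with it both domain edges of \<open>\<beta>\<close>; so
    \<open>\<beta> \<cdot> k\<close> lands in the tensor product.\<close>
  obtain e where [simp]: "e \<in> Arr C" "Dom C e = Dom C (\<beta> \<cdot> k)" "Cod C e = Dom C t"
      and e: "t \<cdot> e = \<beta> \<cdot> k"
    by (rule is_normalisation_factor[OF assms(9), of "\<beta> \<cdot> k"]; (assumption | simp add: U\<beta>k L\<beta>k))
  \<comment> \<open>By \<open>SU\<beta>\<close> and \<open>SL\<beta>\<close>, \<open>y\<close> has zero components in \<open>M \<times> N\<close> as soon as \<open>\<psi> \<cdot> y\<close> lands in \<open>t\<close>.\<close>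
  have pb: "is_pullback C t' \<psi> e k"
    unfolding is_pullback_def
  proof (intro conjI allI ballI impI)
    have "\<kappa> \<cdot> (t' \<cdot> e) = \<kappa> \<cdot> (\<psi> \<cdot> k)"
      by (simp add: Comp_eq_extend[OF t'] Comp_eq_extend[OF \<psi>] e)
    then show "t' \<cdot> e = \<psi> \<cdot> k"
      by (rule is_mono_cancel[OF is_kernel_is_mono[OF \<kappa>]]) simp_all
    fix T x y
    assume "x \<in> Hom C T (Dom C t')" "y \<in> Hom C T (Dom C \<psi>)" and xy: "t' \<cdot> x = \<psi> \<cdot> y"
    then have [simp]: "x \<in> Arr C" "y \<in> Arr C" "Dom C x = T" "Dom C y = T" "Cod C x = Dom C t"
        "Cod C y = Cod C i"
      by auto
    have txy: "t \<cdot> x = \<beta> \<cdot> y"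
      using arg_cong[OF xy, of "\<lambda>f. \<kappa> \<cdot> f"] by (simp add: Comp_eq_extend[OF t'] Comp_eq_extend[OF \<psi>])
    have "is_zero C (kM \<cdot> (p \<cdot> (r \<cdot> y)))"
      using is_zero_Comp_right[OF t(3), of x] Comp_eq_extend[OF SU\<beta>, of y] by (simp add: txy)
    then have pry: "is_zero C (p \<cdot> (r \<cdot> y))"
      by (rule is_zero_mono_reflect[OF pointed is_kernel_is_mono[OF kM]]) simp_all
    have "is_zero C (kN \<cdot> (q \<cdot> (r \<cdot> y)))"
      using is_zero_Comp_right[OF t(4), of x] Comp_eq_extend[OF SL\<beta>, of y] by (simp add: txy)
    then have qry: "is_zero C (q \<cdot> (r \<cdot> y))"
      by (rule is_zero_mono_reflect[OF pointed is_kernel_is_mono[OF kN]]) simp_all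
    have [simp]: "T \<in> Obj C"
      using Dom_in_Obj[of x] by simp
    obtain z where z: "is_zero C z" and [simp]: "z \<in> Arr C" "Dom C z = T" "Cod C z = Dom C p"
      by (rule is_zero_exists[OF pointed, of T "Dom C p"]; (assumption | simp))
    have "r \<cdot> y = z"
    proof (rule is_product_jointly_mono[OF pq])
      show "p \<cdot> (r \<cdot> y) = p \<cdot> z"
        by (rule is_zero_unique[OF pry is_zero_Comp_left[OF z]]) simp_all
      show "q \<cdot> (r \<cdot> y) = q \<cdot> z"
        by (rule is_zero_unique[OF qry is_zero_Comp_left[OF z]]) simp_all
    qed simp_all
    with z have ry: "is_zero C (r \<cdot> y)"
      by simp
    obtain u where [simp]: "u \<in> Arr C" "Dom C u = Dom C y" "Cod C u = Dom C k" and u: "k \<cdot> u = y"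
      by (rule is_kernel_factor[OF k, of y]; (assumption | simp add: ry))
    have "t \<cdot> (e \<cdot> u) = t \<cdot> x"
      by (simp add: Comp_eq_extend[OF e] u txy)
    then have "e \<cdot> u = x"
      by (rule is_mono_cancel[OF t(1)]) simp_all
    moreover have "v = u" if "v \<in> Hom C T (Dom C e)" "k \<cdot> v = y" for v
      by (rule is_mono_cancel[OF is_kernel_is_mono[OF k]]) (use that u in simp_all)
    moreover have "u \<in> Hom C T (Dom C e)"
      by simp
    ultimately show "\<exists>!u. u \<in> Hom C T (Dom C e) \<and> e \<cdot> u = x \<and> k \<cdot> u = y"
      using u by blast
  qed simp_all
  have reg_e: "is_regular_epi C e"
    by (rule is_regular_pullback_stable[OF regular pb \<open>is_regular_epi C \<psi>\<close>])

  \<comment> \<open>Last corners and the image of the canonical map\<close>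
  obtain g z where "is_double_functor C D E g (Ident C (arrows_object C (GR D)))
        (Ident C (arrows_object C (GS D))) (Ident C (objects_object C (GR D)))"
      and z: "is_normalisation C E z" "Dom C z = Dom C w"
      and "Tgt (GR E) \<cdot> (Tgt (GU E) \<cdot> z) = w" and h: "h \<in> Hom C (Dom C t) (Dom C w)"
      and zh: "z \<cdot> h = g \<cdot> t"
    using assms(12) unfolding is_canonical_map_def by blast
  then have g: "is_internal_functor C (GU D) (GU E) g (Ident C (arrows_object C R))"
    and w: "Tgt R \<cdot> (Tgt (GU E) \<cdot> z) = w"
    unfolding is_double_functor_def by simp_all
  note [simp] = z(2) h[unfolded Hom_iff]
  note [simp] = is_mono_arr[OF is_normalisationD(1)[OF z(1)]] is_normalisationD(2)[OF z(1)]
    is_internal_functorD(1-3)[OF g]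
  have [simp]: "Cod C (Src (GU E)) = Dom C (Src R)"
    using is_internal_functorD(6)[OF g] by (simp add: arrows_object_def)
  \<comment> \<open>Being the identity on \<open>R\<close>, \<open>g\<close> preserves the codomain
    edge, and hence the last corner, of every square. On the normalisation of \<open>E\<close> the
    last corner is the inclusion \<open>w\<close>, so \<open>w \<cdot> (h \<cdot> e)\<close> is the
    last corner of \<open>\<beta> \<cdot> k\<close>.\<close>
  have "Tgt (GU E) \<cdot> g = Tgt (GU D)"
    using is_internal_functorD(8)[OF g] by (simp add: arrows_object_def)
  then have Tg: "Tgt (GU E) \<cdot> (g \<cdot> x) = Tgt (GU D) \<cdot> x"
    if "x \<in> Arr C" "Cod C x = Dom C (Src (GU D))" for x
    by (rule Comp_eq_extend) (simp_all add: that)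
  have "w \<cdot> (h \<cdot> e) = Tgt R \<cdot> (Tgt (GU E) \<cdot> (z \<cdot> (h \<cdot> e)))"
    using arg_cong[OF w, of "\<lambda>f. f \<cdot> (h \<cdot> e)"] by simp
  also have "\<dots> = Tgt R \<cdot> (Tgt (GU D) \<cdot> (\<beta> \<cdot> k))"
    by (simp add: Comp_eq_extend[OF zh] Tg e)
  also have "\<dots> = \<tau> \<cdot> k"
    using arg_cong[OF corner\<beta>, of "\<lambda>f. f \<cdot> k"] by simp
  finally have whe: "w \<cdot> (h \<cdot> e) = \<tau> \<cdot> k" .
  have [simp]: "Cod C w = Cod C m"
    using arg_cong[OF w, of "Cod C"] by simp
  obtain e' where e': "e' \<in> Hom C (Dom C (\<tau> \<cdot> k)) (Dom C c)" and ce': "c \<cdot> e' = \<tau> \<cdot> k"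
      and "is_mono C c"
    using c unfolding is_image_def by blast
  then have "Cod C (c \<cdot> e') = Cod C c"
    using is_mono_arr[of c] by (intro Comp_arr) simp_all
  then have "Cod C c = Cod C m"
    by (simp add: ce')
  then show ?thesis
    by (intro is_image_regular_epi_Comp[OF reg_e is_intersection_is_mono[OF assms(11)]])
      (simp_all add: c whe)
qed

end
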